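(* Let $\epsilon\in[0,1]$, $T_c,T_s>0$ and $t_0^s\in\mathbb{R}$, and suppose the source alphabet and the channel-input alphabet coincide, $\mathcal{U}=\mathcal{V}$ with $|\mathcal{V}|=q\ge 2$. Consider the policy that keeps transmitting the last-generated source symbol until a new one is generated, at which point it starts transmitting the newly generated symbol and discards all previous ones (LCFS with no buffer); that is, the coding scheme $\mathcal{C}^\ast$ with encoders $f_i(u_1,\dots,u_{M_i})=u_{M_i}$ whenever $M_i\ge 1$, where $M_i=\lfloor (iT_c-t_0^s)/T_s\rfloor$, together with the age-optimal decoders. Then $\mathcal{C}^\ast$ is optimal from an age perspective over the channel $q\mathrm{EC}(\epsilon)$: $\Delta_{\epsilon,\mathcal{C}^\ast}\le \Delta_{\epsilon,\mathcal{C}}$ for every coding scheme $\mathcal{C}$.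
   Context: Channel: $q\mathrm{EC}(\epsilon)$ is the memoryless $q$-ary erasure channel with input alphabet $\mathcal{V}=\{0,\dots,q-1\}$ and output alphabet $\mathcal{V}\cup\{?\}$; each channel input is independently replaced by the erasure symbol $?$ with probability $\epsilon$ and otherwise received unchanged and instantaneously. There is no feedback. The $i$-th channel use ($i\ge1$) takes place at time $iT_c$. Source: a discrete memoryless source produces i.i.d. symbols $U_1,U_2,\dots\in\mathcal{U}$ (every letter of $\mathcal{U}$ having positive probability), independent of the erasures; $U_m$ is generated at time $mT_s+t_0^s$. Coding scheme: $\mathcal{C}=(f_i,g_i)_{i\ge1}$ where, with $M_i=\lfloor (iT_c-t_0^s)/T_s\rfloor$ (read as $0$ if negative), the encoder $f_i:\mathcal{U}^{M_i}\to\mathcal{V}$ produces the $i$-th channel input from $U_1,\dots,U_{M_i}$, and the decoder $g_i:(\mathcal{V}\cup\{?\})^i\to(\mathcal{U}\times\{1,\dots,M_i\})\cup\{\textsc{erasure}\}$ is applied to the first $i$ channel outputs. Decoders never err: if $g_i(Z_1,\dots,Z_i)=(\hat U,m)$ then $\hat U=U_m$ with probability 1. For given encoders, the age-optimal decoder outputs $(U_{m_i},m_i)$, where $m_i$ is the largest index in $\{1,\dots,M_i\}$ such that $U_{m_i}$ is uniquely determined by $Z_1,\dots,Z_i$ (and $\textsc{erasure}$ if there is none). Age: for $t\in[iT_c,(i+1)T_c)$ the instantaneous age is $\Delta_{\epsilon,\mathcal{C}}(t)=t-mT_s-t_0^s$, where $m$ is the index output by the decoder at channel use $i$ ($m=0$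 if the output is $\textsc{erasure}$ or if $i=0$). The average age is $\Delta_{\epsilon,\mathcal{C}}=\lim_{\tau\to\infty}\frac1\tau\int_0^\tau\Delta_{\epsilon,\mathcal{C}}(t)\,dt$ (possibly $+\infty$), understood almost surely; only schemes for which this limit exists almost surely and is almost surely constant are considered. *)

theory Defs
  imports "HOL-Probability.Probability"
begin

(* Source symbols and channel uses are numbered from 1; index 0 of U and E is never used. *)

definition memoryless_source :: "'w measure \<Rightarrow> (nat \<Rightarrow> 'w \<Rightarrow> 'u) \<Rightarrow> bool" where
  "memoryless_source M U \<longleftrightarrow>
     prob_space.indep_vars M (\<lambda>_. count_space UNIV) U {1..} \<and>
     (\<exists>p :: 'u pmf. (\<forall>u. pmf p u > 0) \<and>
        (\<forall>m\<ge>1. distr M (count_space UNIV) (U m) = measure_pmf p))"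

(* E i is the event that the i-th channel input is erased. *)
definition memoryless_erasures :: "'w measure \<Rightarrow> (nat \<Rightarrow> 'w \<Rightarrow> bool) \<Rightarrow> real \<Rightarrow> bool" where
  "memoryless_erasures M E \<epsilon> \<longleftrightarrow>
     prob_space.indep_vars M (\<lambda>_. count_space UNIV) E {1..} \<and>
     (\<forall>i\<ge>1. prob_space.prob M {\<omega> \<in> space M. E i \<omega>} = \<epsilon>)"

(* Independence of the sigma-algebras generated by the two processes; indep_var only covers
   random variables of one common type. *)
definition source_indep_erasures ::
    "'w measure \<Rightarrow> (nat \<Rightarrow> 'w \<Rightarrow> 'u) \<Rightarrow> (nat \<Rightarrow> 'w \<Rightarrow> bool) \<Rightarrow> bool" where
  "source_indep_erasures M U E \<longleftrightarrow>
     prob_space.indep_set M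
       {(\<lambda>\<omega>. \<lambda>m\<in>{1..}. U m \<omega>) -` A \<inter> space M |A. A \<in> sets (Pi\<^sub>M {1..} (\<lambda>_. count_space UNIV))}
       {(\<lambda>\<omega>. \<lambda>i\<in>{1..}. E i \<omega>) -` B \<inter> space M |B. B \<in> sets (Pi\<^sub>M {1..} (\<lambda>_. count_space UNIV))}"

(* The number M_i of source symbols generated up to the i-th channel use; nat maps negative
   values of the floor to 0. *)
definition num_generated :: "real \<Rightarrow> real \<Rightarrow> real \<Rightarrow> nat \<Rightarrow> nat" where
  "num_generated Tc Ts t0 i = nat \<lfloor>(real i * Tc - t0) / Ts\<rfloor>"

(* enc i is only ever applied to words of length M_i, and dec i to words of length i. In a
   channel output None is the erasure symbol "?"; as a decoder output None is ERASURE. *)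
record ('u, 'v) coding_scheme =
  enc :: "nat \<Rightarrow> 'u list \<Rightarrow> 'v"
  dec :: "nat \<Rightarrow> 'v option list \<Rightarrow> ('u \<times> nat) option"

definition source_word :: "(nat \<Rightarrow> 'w \<Rightarrow> 'u) \<Rightarrow> nat \<Rightarrow> 'w \<Rightarrow> 'u list" where
  "source_word U n \<omega> = map (\<lambda>m. U m \<omega>) [1..<Suc n]"

definition channel_output ::
    "real \<Rightarrow> real \<Rightarrow> real \<Rightarrow> (nat \<Rightarrow> 'w \<Rightarrow> 'u) \<Rightarrow> (nat \<Rightarrow> 'w \<Rightarrow> bool) \<Rightarrow>
     (nat \<Rightarrow> 'u list \<Rightarrow> 'v) \<Rightarrow> nat \<Rightarrow> 'w \<Rightarrow> 'v option" where
  "channel_output Tc Ts t0 U E f i \<omega> =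
     (if E i \<omega> then None else Some (f i (source_word U (num_generated Tc Ts t0 i) \<omega>)))"

definition channel_outputs ::
    "real \<Rightarrow> real \<Rightarrow> real \<Rightarrow> (nat \<Rightarrow> 'w \<Rightarrow> 'u) \<Rightarrow> (nat \<Rightarrow> 'w \<Rightarrow> bool) \<Rightarrow>
     (nat \<Rightarrow> 'u list \<Rightarrow> 'v) \<Rightarrow> nat \<Rightarrow> 'w \<Rightarrow> 'v option list" where
  "channel_outputs Tc Ts t0 U E f i \<omega> =
     map (\<lambda>j. channel_output Tc Ts t0 U E f j \<omega>) [1..<Suc i]"

definition valid_scheme ::
    "'w measure \<Rightarrow> real \<Rightarrow> real \<Rightarrow> real \<Rightarrow> (nat \<Rightarrow> 'w \<Rightarrow> 'u) \<Rightarrow> (nat \<Rightarrow> 'w \<Rightarrow> bool) \<Rightarrow>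
     ('u, 'v) coding_scheme \<Rightarrow> bool" where
  "valid_scheme M Tc Ts t0 U E C \<longleftrightarrow>
     (\<forall>i\<ge>1. \<forall>z u m. length z = i \<longrightarrow> dec C i z = Some (u, m) \<longrightarrow>
        m \<in> {1..num_generated Tc Ts t0 i}) \<and>
     (\<forall>i\<ge>1. AE \<omega> in M. \<forall>u m.
        dec C i (channel_outputs Tc Ts t0 U E (enc C) i \<omega>) = Some (u, m) \<longrightarrow> u = U m \<omega>)"

(* The source word w could have led to the first i channel outputs z. *)
definition consistent_word ::
    "real \<Rightarrow> real \<Rightarrow> real \<Rightarrow> (nat \<Rightarrow> 'u list \<Rightarrow> 'v) \<Rightarrow> nat \<Rightarrow> 'v option list \<Rightarrow> 'u list \<Rightarrow> bool" where
  "consistent_word Tc Ts t0 f i z w \<longleftrightarrow>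
     length w = num_generated Tc Ts t0 i \<and>
     (\<forall>j\<in>{1..i}. z ! (j - 1) = None \<or>
        z ! (j - 1) = Some (f j (take (num_generated Tc Ts t0 j) w)))"

definition determines ::
    "real \<Rightarrow> real \<Rightarrow> real \<Rightarrow> (nat \<Rightarrow> 'u list \<Rightarrow> 'v) \<Rightarrow> nat \<Rightarrow> 'v option list \<Rightarrow> nat \<Rightarrow> 'u \<Rightarrow> bool" where
  "determines Tc Ts t0 f i z m u \<longleftrightarrow>
     (\<exists>w. consistent_word Tc Ts t0 f i z w) \<and>
     (\<forall>w. consistent_word Tc Ts t0 f i z w \<longrightarrow> w ! (m - 1) = u)"

definition age_optimal_decoder ::
    "real \<Rightarrow> real \<Rightarrow> real \<Rightarrow> (nat \<Rightarrow> 'u list \<Rightarrow> 'v) \<Rightarrow> nat \<Rightarrow> 'v option list \<Rightarrow> ('u \<times> nat) option" where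
  "age_optimal_decoder Tc Ts t0 f i z =
     (let S = {m \<in> {1..num_generated Tc Ts t0 i}. \<exists>u. determines Tc Ts t0 f i z m u}
      in if S = {} then None
         else Some (THE u. determines Tc Ts t0 f i z (Max S) u, Max S))"

definition decoded_index ::
    "real \<Rightarrow> real \<Rightarrow> real \<Rightarrow> (nat \<Rightarrow> 'w \<Rightarrow> 'u) \<Rightarrow> (nat \<Rightarrow> 'w \<Rightarrow> bool) \<Rightarrow>
     ('u, 'v) coding_scheme \<Rightarrow> nat \<Rightarrow> 'w \<Rightarrow> nat" where
  "decoded_index Tc Ts t0 U E C i \<omega> =
     (if i = 0 then 0
      else case dec C i (channel_outputs Tc Ts t0 U E (enc C) i \<omega>) of
        None \<Rightarrow> 0 | Some (u, m) \<Rightarrow> m)"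

(* For t in [i Tc, (i + 1) Tc) the index i is the floor of t / Tc. *)
definition inst_age ::
    "real \<Rightarrow> real \<Rightarrow> real \<Rightarrow> (nat \<Rightarrow> 'w \<Rightarrow> 'u) \<Rightarrow> (nat \<Rightarrow> 'w \<Rightarrow> bool) \<Rightarrow>
     ('u, 'v) coding_scheme \<Rightarrow> 'w \<Rightarrow> real \<Rightarrow> real" where
  "inst_age Tc Ts t0 U E C \<omega> t =
     t - real (decoded_index Tc Ts t0 U E C (nat \<lfloor>t / Tc\<rfloor>) \<omega>) * Ts - t0"

(* The limit defining the average age exists almost surely and equals the constant D. *)
definition has_average_age ::
    "'w measure \<Rightarrow> real \<Rightarrow> real \<Rightarrow> real \<Rightarrow> (nat \<Rightarrow> 'w \<Rightarrow> 'u) \<Rightarrow> (nat \<Rightarrow> 'w \<Rightarrow> bool) \<Rightarrow>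
     ('u, 'v) coding_scheme \<Rightarrow> ereal \<Rightarrow> bool" where
  "has_average_age M Tc Ts t0 U E C D \<longleftrightarrow>
     (AE \<omega> in M. ((\<lambda>\<tau>. ereal (1 / \<tau> * integral {0..\<tau>} (inst_age Tc Ts t0 U E C \<omega>)))
        \<longlongrightarrow> D) at_top)"

end

theory Submission
  imports Defs "HOL-Library.Discrete_Functions"
begin

text \<open>The outputs of the first \<open>i\<close> channel uses depend only on the erasures and on the symbols generated
  up to the last unerased use, so no error-free decoder can output anything newer, whatever the
  encoders; the LCFS policy always delivers exactly the newest of these symbols. Hence it is optimal
  almost surely at every time, not only on average, and what remains is that its average age exists.

  Let \<open>W i\<close> be the number of generated symbols that are newer than the one delivered at use \<open>i\<close>. Then
  \<open>W (i + 1)\<close> is \<open>W i\<close> plus the number of new symbols if use \<open>i + 1\<close> is erased, and \<open>0\<close> otherwise;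
  replacing the erasure indicator by its mean changes this recursion by orthogonal increments bounded in
  mean square, and a strong law for these gives the Cesaro limit of \<open>W\<close>. The delay between
  generation and transmission is \<open>Ts\<close> times the fractional part of an arithmetic progression, whose Cesaro
  limit exists for rational and irrational \<open>Tc / Ts\<close> alike. For \<open>\<epsilon> = 1\<close> the age is infinite.\<close>

section \<open>Means of fractional parts\<close>

text \<open>Each unit shift only exchanges one boundary term for another, at a cost of at most
  \<open>2 * c\<close>.\<close>

lemma sum_shift_bound:
  fixes x :: "nat \<Rightarrow> real"
  assumes "\<And>i. \<bar>x i\<bar> \<le> c"
  shows "\<bar>(\<Sum>i<n. x (i + r)) - (\<Sum>i<n. x i)\<bar> \<le> 2 * real r * c"
proof (induction r)
  case (Suc r)
  have "(\<Sum>i<n. x (i + Suc r)) - (\<Sum>i<n. x (i + r)) = x (n + r) - x r"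
    using sum_lessThan_telescope[of "\<lambda>i. x (i + r)" n] by (simp add: sum_subtractf)
  then show ?case
    using Suc.IH assms[of "n + r"] assms[of r] by (auto simp: algebra_simps abs_le_iff)
qed simp

lemma bounded_div_tendsto_zero:
  fixes g :: "nat \<Rightarrow> real"
  assumes "\<And>n. \<bar>g n\<bar> \<le> B"
  shows "(\<lambda>n. g n / real n) \<longlonglongrightarrow> 0"
proof (rule Lim_null_comparison)
  show "\<forall>\<^sub>F n in sequentially. norm (g n / real n) \<le> B / real n"
    using assms by (simp add: divide_right_mono)
  show "(\<lambda>n. B / real n) \<longlonglongrightarrow> 0" by (rule lim_const_over_n)
qed

text \<open>Removing the linear trend, whose slope is the mean over one period, from the partial
  sums leaves a periodic and hence bounded sequence \<open>g\<close>.\<close>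

lemma periodic_mean_convergent:
  fixes x :: "nat \<Rightarrow> real"
  assumes per: "\<And>i. x (i + r) = x i" and r: "r > 0"
  shows "\<exists>L. (\<lambda>n. (\<Sum>i<n. x i) / real n) \<longlonglongrightarrow> L"
proof -
  define A where "A = (\<Sum>i<r. x i)"
  define g where "g n = (\<Sum>i<n. x i) - real n * (A / real r)" for n
  have S: "(\<Sum>i<n + r. x i) = (\<Sum>i<n. x i) + A" for n
  proof (induction n)
    case (Suc n) then show ?case by (simp add: per)
  qed (simp add: A_def)
  have g: "g (n + r) = g n" for n
    using r by (simp add: g_def S algebra_simps add_divide_distrib)
  have gmul: "g (m + k * r) = g m" for m k
  proof (induction k)
    case (Suc k) then show ?case using g[of "m + k * r"] by (simp add: algebra_simps)
  qed simp
  have gmod: "g n = g (n mod r)" for n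
    using gmul[of "n mod r" "n div r"] by simp
  have "\<bar>g n\<bar> \<le> Max ((\<lambda>i. \<bar>g i\<bar>) ` {..<r})" for n
    by (subst gmod, rule Max_ge) (use r in auto)
  then have "(\<lambda>n. g n / real n) \<longlonglongrightarrow> 0" by (rule bounded_div_tendsto_zero)
  then have "(\<lambda>n. g n / real n + A / real r) \<longlonglongrightarrow> 0 + A / real r"
    by (intro tendsto_intros)
  moreover have "\<forall>\<^sub>F n in sequentially. g n / real n + A / real r = (\<Sum>i<n. x i) / real n"
    using eventually_gt_at_top[of 0]
    by eventually_elim (simp add: g_def field_simps)
  ultimately show ?thesis by (intro exI) (rule Lim_transform_eventually)
qed

text \<open>The parabola \<open>y\<^sup>2 - y\<close> is symmetric about 1/2, so among all integer
  translates of a point the one in [0, 1) gives the least value.\<close>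

lemma frac_quadratic_le: "(frac y)\<^sup>2 - frac y \<le> y\<^sup>2 - (y::real)"
proof -
  define n where "n = \<lfloor>y\<rfloor>"
  have y: "y = frac y + of_int n" by (simp add: frac_def n_def)
  have "0 \<le> real_of_int n * (of_int n - 1 + 2 * frac y)"
  proof (cases "n \<ge> 1")
    case True then show ?thesis using frac_ge_0[of y] by (intro mult_nonneg_nonneg) auto
  next
    case False
    then consider "n = 0" | "n \<le> -1" by linarith
    then show ?thesis
    proof cases
      case 2
      then have "real_of_int n \<le> -1" by linarith
      then show ?thesis using frac_lt_1[of y] by (intro mult_nonpos_nonpos) auto
    qed simp
  qed
  also have "\<dots> = (y\<^sup>2 - y) - ((frac y)\<^sup>2 - frac y)"
    by (subst (2) y, subst (2) y) (simp add: power2_eq_square algebra_simps)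
  finally show ?thesis by simp
qed

text \<open>The bound holds for both signs of \<open>\<theta>\<close> and also when the step wraps around, so telescoping it in
  both directions controls a sum of fractional parts without counting the wraps.\<close>

lemma frac_quadratic_increment_le:
  fixes x y \<theta> :: real
  assumes "y - x - \<theta> \<in> \<int>"
  shows "((frac y)\<^sup>2 - frac y) - ((frac x)\<^sup>2 - frac x) \<le> 2 * \<theta> * (frac x - 1 / 2) + \<theta>\<^sup>2"
proof -
  have "y - (frac x + \<theta>) = (y - x - \<theta>) + of_int \<lfloor>x\<rfloor>" by (simp add: frac_def)
  also have "\<dots> \<in> \<int>" using assms by (rule Ints_add) simp
  finally obtain k where "y = frac x + \<theta> + of_int k" by (metis Ints_cases add.commute diff_add_cancel)
  then have "frac y = frac (frac x + \<theta>)" by (simp add: frac_def)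
  then have "(frac y)\<^sup>2 - frac y \<le> (frac x + \<theta>)\<^sup>2 - (frac x + \<theta>)"
    using frac_quadratic_le by metis
  then show ?thesis by (simp add: power2_eq_square algebra_simps)
qed

text \<open>Modulo 1, \<open>r\<close> steps of the progression amount to a shift by
  \<open>\<theta>\<close>. Divided by \<open>n\<close>, the bound leaves a mean deviation from 1/2
  of about \<open>\<bar>\<theta>\<bar> / 2\<close>, so a small nonzero \<open>\<theta>\<close> is
  what makes it useful.\<close>

lemma frac_progression_sum_bound:
  fixes \<alpha> \<beta> \<theta> :: real
  assumes th: "real r * \<alpha> - \<theta> \<in> \<int>"
  shows "2 * \<bar>\<theta>\<bar> * \<bar>\<Sum>i<n. frac (real i * \<alpha> + \<beta>) - 1 / 2\<bar>
           \<le> 2 * real r + 4 * real r * \<bar>\<theta>\<bar> + real n * \<theta>\<^sup>2"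
proof -
  define s where "s i = frac (real i * \<alpha> + \<beta>)" for i
  define P where "P i = (s i)\<^sup>2 - s i" for i
  define T where "T = (\<Sum>i<n. s i - 1 / 2)"
  define T' where "T' = (\<Sum>i<n. s (i + r) - 1 / 2)"
  define A where "A = (\<Sum>i<n. P (i + r)) - (\<Sum>i<n. P i)"
  have s01: "0 \<le> s i" "s i \<le> 1" for i using frac_lt_1[of "real i * \<alpha> + \<beta>"] by (auto simp: s_def)
  have Pb: "\<bar>P i\<bar> \<le> 1" for i
  proof -
    have "P i = - (s i * (1 - s i))" by (simp add: P_def power2_eq_square algebra_simps)
    moreover have "0 \<le> s i * (1 - s i)" "s i * (1 - s i) \<le> 1 * 1"
      using s01[of i] mult_le_one[of "s i" "1 - s i"] by auto
    ultimately show ?thesis by simp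
  qed
  have A: "\<bar>A\<bar> \<le> 2 * real r"
    using sum_shift_bound[of P 1 r n] Pb by (simp add: A_def)
  \<comment> \<open>The increment bound taken backwards is centred at the shifted terms and so
    controls \<open>T'\<close>, which must be compared with \<open>T\<close>.\<close>
  have TT: "\<bar>T' - T\<bar> \<le> 2 * real r"
  proof -
    have "\<bar>s i - 1 / 2\<bar> \<le> 1" for i using s01[of i] by (simp add: abs_le_iff)
    from sum_shift_bound[of "\<lambda>i. s i - 1 / 2", OF this] show ?thesis
      by (simp add: T_def T'_def)
  qed
  have up: "P (i + r) - P i \<le> 2 * \<theta> * (s i - 1 / 2) + \<theta>\<^sup>2" for i
    unfolding P_def s_def using th
    by (intro frac_quadratic_increment_le) (simp add: algebra_simps)
  have dn: "P i - P (i + r) \<le> 2 * (-\<theta>) * (s (i + r) - 1 / 2) + (-\<theta>)\<^sup>2" for i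
    unfolding P_def s_def
    by (intro frac_quadratic_increment_le)
      (use Ints_minus[OF th] in \<open>simp add: algebra_simps\<close>)
  have "A \<le> (\<Sum>i<n. 2 * \<theta> * (s i - 1 / 2) + \<theta>\<^sup>2)"
    unfolding A_def sum_subtractf[symmetric] by (intro sum_mono up)
  then have 1: "A \<le> 2 * \<theta> * T + real n * \<theta>\<^sup>2"
    by (simp add: T_def sum.distrib flip: sum_distrib_left)
  have "- A \<le> (\<Sum>i<n. 2 * (-\<theta>) * (s (i + r) - 1 / 2) + (-\<theta>)\<^sup>2)"
    using sum_mono[of "{..<n}", OF dn] by (simp add: A_def sum_subtractf)
  then have 2: "2 * \<theta> * T' \<le> A + real n * \<theta>\<^sup>2"
    by (simp add: T'_def sum_subtractf flip: sum_distrib_left)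
  have "\<bar>2 * \<theta> * (T' - T)\<bar> \<le> 2 * \<bar>\<theta>\<bar> * (2 * real r)"
    using TT unfolding abs_mult by (intro mult_mono) auto
  then have "2 * \<theta> * T \<le> 2 * \<theta> * T' + 4 * real r * \<bar>\<theta>\<bar>"
    by (auto simp: algebra_simps abs_le_iff)
  then have "\<bar>2 * \<theta> * T\<bar> \<le> 2 * real r + 4 * real r * \<bar>\<theta>\<bar> + real n * \<theta>\<^sup>2"
    using 1 2 A mult_nonneg_nonneg[of "real r" "\<bar>\<theta>\<bar>"] by linarith
  then show ?thesis by (simp add: T_def s_def abs_mult)
qed

text \<open>For rational \<open>\<alpha>\<close> the sequence is periodic. For irrational
  \<open>\<alpha>\<close> the mean is 1/2: some multiple of \<open>\<alpha>\<close> is arbitrarily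
  close, but not equal, to an integer.\<close>

lemma frac_progression_mean_convergent:
  fixes \<alpha> \<beta> :: real
  shows "\<exists>L. (\<lambda>n. (\<Sum>i<n. frac (real i * \<alpha> + \<beta>)) / real n) \<longlonglongrightarrow> L"
proof (cases "\<exists>r>0. real r * \<alpha> \<in> \<int>")
  case True
  then obtain r where r: "r > 0" "real r * \<alpha> \<in> \<int>" by blast
  then obtain k where k: "real r * \<alpha> = of_int k" by (auto elim: Ints_cases)
  show ?thesis
  proof (rule periodic_mean_convergent[OF _ \<open>r > 0\<close>])
    fix i
    have "real (i + r) * \<alpha> + \<beta> = (real i * \<alpha> + \<beta>) + of_int k" using k by (simp add: algebra_simps)
    then show "frac (real (i + r) * \<alpha> + \<beta>) = frac (real i * \<alpha> + \<beta>)"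
      by (simp only: frac_add_of_int_right)
  qed
next
  case False
  define T where "T n = (\<Sum>i<n. frac (real i * \<alpha> + \<beta>) - 1 / 2)" for n
  have "(\<lambda>n. T n / real n) \<longlonglongrightarrow> 0"
  proof (rule LIMSEQ_I)
    fix \<delta> :: real assume \<delta>: "\<delta> > 0"
    obtain N :: nat where N: "N > 0" "1 / real N < \<delta>"
      by (metis \<delta> gr_zeroI inverse_eq_divide real_arch_inverse)
    obtain h k where hk: "0 < k" "k \<le> int N" "\<bar>of_int k * \<alpha> - of_int h\<bar> < 1 / real N"
      using Dirichlet_approx[OF N(1)] by blast
    define r where "r = nat k"
    define \<theta> where "\<theta> = real r * \<alpha> - of_int h"
    have r: "r > 0" "of_int k = real r" using hk by (auto simp: r_def)
    have th: "real r * \<alpha> - \<theta> \<in> \<int>" by (simp add: \<theta>_def)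
    have "\<theta> \<noteq> 0"
    proof
      assume "\<theta> = 0"
      then have "real r * \<alpha> \<in> \<int>" by (simp add: \<theta>_def)
      then show False using False r by blast
    qed
    have th\<delta>: "\<bar>\<theta>\<bar> < \<delta>" using hk(3) N(2) unfolding \<theta>_def r(2)[symmetric] by linarith
    \<comment> \<open>The part of the bound that does not grow with \<open>n\<close>, after division
      by \<open>2 * \<bar>\<theta>\<bar>\<close>; it may be huge for small \<open>\<theta>\<close>,
      but \<open>r\<close> and \<open>\<theta>\<close> are fixed before \<open>n\<close>
      grows.\<close>
    define c where "c = (2 * real r + 4 * real r * \<bar>\<theta>\<bar>) / (2 * \<bar>\<theta>\<bar>)"
    have b: "\<bar>T n\<bar> \<le> c + real n * \<bar>\<theta>\<bar> / 2" for n
    proof -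
      have "2 * \<bar>\<theta>\<bar> * \<bar>T n\<bar> \<le> 2 * \<bar>\<theta>\<bar> * (c + real n * \<bar>\<theta>\<bar> / 2)"
      proof -
        have "2 * \<bar>\<theta>\<bar> * c = 2 * real r + 4 * real r * \<bar>\<theta>\<bar>"
          using \<open>\<theta> \<noteq> 0\<close> by (simp add: c_def)
        moreover have "2 * \<bar>\<theta>\<bar> * (real n * \<bar>\<theta>\<bar> / 2) = real n * \<theta>\<^sup>2"
          by (simp add: power2_eq_square)
        ultimately show ?thesis
          using frac_progression_sum_bound[OF th, of \<beta> n] unfolding T_def distrib_left by linarith
      qed
      then show ?thesis using \<open>\<theta> \<noteq> 0\<close> by (simp add: mult_le_cancel_left)
    qed
    have "\<forall>\<^sub>F n in sequentially. c / real n < \<delta> / 2"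
      by (rule order_tendstoD(2)[OF lim_const_over_n]) (use \<delta> in simp)
    then have "\<forall>\<^sub>F n in sequentially. norm (T n / real n - 0) < \<delta>"
      using eventually_gt_at_top[of 0]
    proof eventually_elim
      case (elim n)
      have "\<bar>T n\<bar> / real n \<le> (c + real n * \<bar>\<theta>\<bar> / 2) / real n" by (intro divide_right_mono b) simp
      also have "\<dots> = c / real n + \<bar>\<theta>\<bar> / 2" using elim by (simp add: field_simps)
      finally have "\<bar>T n\<bar> / real n < \<delta>" using elim(1) th\<delta> by linarith
      then show ?case by simp
    qed
    then show "\<exists>no. \<forall>n\<ge>no. norm (T n / real n - 0) < \<delta>" by (simp add: eventually_sequentially)
  qed
  then have "(\<lambda>n. T n / real n + 1 / 2) \<longlonglongrightarrow> 0 + 1 / 2" by (intro tendsto_intros)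
  moreover have "\<forall>\<^sub>F n in sequentially.
      T n / real n + 1 / 2 = (\<Sum>i<n. frac (real i * \<alpha> + \<beta>)) / real n"
    using eventually_gt_at_top[of 0]
    by eventually_elim (simp add: T_def sum_subtractf diff_divide_distrib)
  ultimately show ?thesis by (intro exI) (rule Lim_transform_eventually)
qed

section \<open>A strong law for orthogonal random variables\<close>

context prob_space
begin

text \<open>The series of the \<open>f n\<close> has finite expectation, hence converges almost
  surely, and its terms vanish in the limit.\<close>

lemma AE_tendsto_zero_if_summable_expectation:
  fixes f :: "nat \<Rightarrow> 'a \<Rightarrow> real"
  assumes int: "\<And>n. integrable M (f n)"
    and nonneg: "\<And>n \<omega>. 0 \<le> f n \<omega>"
    and bound: "\<And>n. expectation (f n) \<le> c n"
    and c: "summable c"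
  shows "AE \<omega> in M. (\<lambda>n. f n \<omega>) \<longlonglongrightarrow> 0"
proof -
  have [measurable]: "f n \<in> borel_measurable M" for n using int by (rule borel_measurable_integrable)
  have c0: "0 \<le> c n" for n
    using bound[of n] Bochner_Integration.integral_nonneg[of M "f n"] nonneg
    by (meson order_trans)
  have "(\<integral>\<^sup>+\<omega>. (\<Sum>n. ennreal (f n \<omega>)) \<partial>M) = (\<Sum>n. \<integral>\<^sup>+\<omega>. ennreal (f n \<omega>) \<partial>M)"
    by (rule nn_integral_suminf) simp
  also have "\<dots> = (\<Sum>n. ennreal (expectation (f n)))"
    using int nonneg by (simp add: nn_integral_eq_integral)
  also have "\<dots> \<le> (\<Sum>n. ennreal (c n))"
    using bound by (intro suminf_le) (auto intro: ennreal_leI)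
  also have "\<dots> = ennreal (suminf c)" using c0 c by (rule suminf_ennreal2)
  finally have "(\<integral>\<^sup>+\<omega>. (\<Sum>n. ennreal (f n \<omega>)) \<partial>M) \<noteq> \<infinity>" by (auto simp: top_unique)
  then have "AE \<omega> in M. (\<Sum>n. ennreal (f n \<omega>)) \<noteq> \<infinity>"
    by (intro nn_integral_PInf_AE) auto
  then show ?thesis
  proof eventually_elim
    case (elim \<omega>)
    then show ?case
      using nonneg by (intro summable_LIMSEQ_zero summable_suminf_not_top) auto
  qed
qed

text \<open>After expanding the square, orthogonality leaves only the diagonal terms.\<close>

lemma expectation_square_sum_orthogonal_le:
  fixes X :: "nat \<Rightarrow> 'a \<Rightarrow> real"
  assumes int: "\<And>i j. integrable M (\<lambda>\<omega>. X i \<omega> * X j \<omega>)"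
    and orth: "\<And>i j. i \<noteq> j \<Longrightarrow> expectation (\<lambda>\<omega>. X i \<omega> * X j \<omega>) = 0"
    and bound: "\<And>i. expectation (\<lambda>\<omega>. (X i \<omega>)\<^sup>2) \<le> C"
    and fin: "finite I"
  shows "integrable M (\<lambda>\<omega>. (\<Sum>i\<in>I. X i \<omega>)\<^sup>2)"
    and "expectation (\<lambda>\<omega>. (\<Sum>i\<in>I. X i \<omega>)\<^sup>2) \<le> real (card I) * C"
proof -
  have sq: "(\<lambda>\<omega>. (\<Sum>i\<in>I. X i \<omega>)\<^sup>2) = (\<lambda>\<omega>. \<Sum>i\<in>I. \<Sum>j\<in>I. X i \<omega> * X j \<omega>)"
    by (simp add: power2_eq_square sum_product)
  show "integrable M (\<lambda>\<omega>. (\<Sum>i\<in>I. X i \<omega>)\<^sup>2)"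
    unfolding sq by (intro Bochner_Integration.integrable_sum int)
  have "expectation (\<lambda>\<omega>. (\<Sum>i\<in>I. X i \<omega>)\<^sup>2) = (\<Sum>i\<in>I. \<Sum>j\<in>I. expectation (\<lambda>\<omega>. X i \<omega> * X j \<omega>))"
    unfolding sq by (simp add: int)
  also have "\<dots> = (\<Sum>i\<in>I. \<Sum>j\<in>I. if j = i then expectation (\<lambda>\<omega>. (X i \<omega>)\<^sup>2) else 0)"
    by (intro sum.cong refl) (auto simp: orth power2_eq_square)
  also have "\<dots> = (\<Sum>i\<in>I. expectation (\<lambda>\<omega>. (X i \<omega>)\<^sup>2))"
    using fin by simp
  also have "\<dots> \<le> real (card I) * C"
    using sum_bounded_above[of I, OF bound] by simp
  finally show "expectation (\<lambda>\<omega>. (\<Sum>i\<in>I. X i \<omega>)\<^sup>2) \<le> real (card I) * C" .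
qed

text \<open>Chebyshev gives convergence along the squares; the oscillation of the partial sums between
  \<open>k\<^sup>2\<close> and \<open>(k + 1)\<^sup>2\<close> is bounded in mean square by the sum of all the increments.\<close>

theorem strong_law_orthogonal:
  fixes X :: "nat \<Rightarrow> 'a \<Rightarrow> real"
  assumes int: "\<And>i j. integrable M (\<lambda>\<omega>. X i \<omega> * X j \<omega>)"
    and orth: "\<And>i j. i \<noteq> j \<Longrightarrow> expectation (\<lambda>\<omega>. X i \<omega> * X j \<omega>) = 0"
    and bound: "\<And>i. expectation (\<lambda>\<omega>. (X i \<omega>)\<^sup>2) \<le> C"
  shows "AE \<omega> in M. (\<lambda>n. (\<Sum>i<n. X i \<omega>) / real n) \<longlonglongrightarrow> 0"
proof -
  note sum_sq = expectation_square_sum_orthogonal_le[of X, OF int orth bound]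
  have C: "0 \<le> C" using bound[of 0] Bochner_Integration.integral_nonneg[of M "\<lambda>\<omega>. (X 0 \<omega>)\<^sup>2"]
    by (meson order_trans zero_le_power2)
  \<comment> \<open>The second part dominates the largest squared block sum starting at
    \<open>k\<^sup>2\<close> by the sum of all of them; \<open>2 * k\<close> is the last offset
    before \<open>(k + 1)\<^sup>2\<close>.\<close>
  define T where "T k \<omega> = (\<Sum>i<k\<^sup>2. X i \<omega>)\<^sup>2 + (\<Sum>j\<le>2 * k. (\<Sum>i\<in>{k\<^sup>2..<k\<^sup>2 + j}. X i \<omega>)\<^sup>2)" for k \<omega>
  have T_int: "integrable M (T k)" for k
    unfolding T_def by (intro Bochner_Integration.integrable_add Bochner_Integration.integrable_sum sum_sq) auto
  have T_nonneg: "0 \<le> T k \<omega>" for k \<omega> by (simp add: T_def sum_nonneg)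
  have T_bound: "expectation (T k) \<le> 7 * C * (real k)\<^sup>2" for k
  proof -
    have "expectation (T k) = expectation (\<lambda>\<omega>. (\<Sum>i<k\<^sup>2. X i \<omega>)\<^sup>2)
        + (\<Sum>j\<le>2 * k. expectation (\<lambda>\<omega>. (\<Sum>i\<in>{k\<^sup>2..<k\<^sup>2 + j}. X i \<omega>)\<^sup>2))"
      unfolding T_def by (simp add: sum_sq(1))
    also have "\<dots> \<le> (real k)\<^sup>2 * C + (\<Sum>j\<le>2 * k. real (2 * k) * C)"
    proof (intro add_mono sum_mono)
      show "expectation (\<lambda>\<omega>. (\<Sum>i<k\<^sup>2. X i \<omega>)\<^sup>2) \<le> (real k)\<^sup>2 * C"
        using sum_sq(2)[where I = "{..<k\<^sup>2}"] by simp
      fix j assume "j \<in> {..2 * k}"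
      then have "real j * C \<le> real (2 * k) * C" using C by (intro mult_right_mono) auto
      then show "expectation (\<lambda>\<omega>. (\<Sum>i\<in>{k\<^sup>2..<k\<^sup>2 + j}. X i \<omega>)\<^sup>2) \<le> real (2 * k) * C"
        using sum_sq(2)[where I = "{k\<^sup>2..<k\<^sup>2 + j}"] by simp
    qed
    also have "\<dots> = C * (5 * (real k)\<^sup>2 + 2 * real k)"
      by (simp add: algebra_simps power2_eq_square)
    also have "\<dots> \<le> C * (7 * (real k)\<^sup>2)"
    proof (rule mult_left_mono[OF _ C])
      have "real k \<le> (real k)\<^sup>2" by (cases k) (auto simp: power2_eq_square)
      then show "5 * (real k)\<^sup>2 + 2 * real k \<le> 7 * (real k)\<^sup>2" by simp
    qed
    finally show ?thesis by (simp add: algebra_simps)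
  qed
  \<comment> \<open>The expectation of \<open>T k\<close> is of order \<open>k\<^sup>2\<close>, so
    division by \<open>k ^ 4\<close> gives a summable bound.\<close>
  have "AE \<omega> in M. (\<lambda>k. T k \<omega> / real k ^ 4) \<longlonglongrightarrow> 0"
  proof (rule AE_tendsto_zero_if_summable_expectation)
    show "integrable M (\<lambda>\<omega>. T k \<omega> / real k ^ 4)" for k using T_int by simp
    show "0 \<le> T k \<omega> / real k ^ 4" for k \<omega> using T_nonneg by simp
    show "expectation (\<lambda>\<omega>. T k \<omega> / real k ^ 4) \<le> 7 * C * inverse (real k ^ 2)" for k
    proof (cases "k = 0")
      case False
      have "expectation (\<lambda>\<omega>. T k \<omega> / real k ^ 4) = expectation (T k) / real k ^ 4" by simp
      also have "\<dots> \<le> 7 * C * (real k)\<^sup>2 / real k ^ 4" by (intro divide_right_mono T_bound) simp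
      also have "\<dots> = 7 * C * inverse (real k ^ 2)"
        using False by (simp add: field_simps flip: power_add)
      finally show ?thesis .
    qed simp
    show "summable (\<lambda>k. 7 * C * inverse (real k ^ 2))"
      by (intro summable_mult inverse_power_summable) simp
  qed
  then show ?thesis
  proof eventually_elim
    case (elim \<omega>)
    define S where "S n = (\<Sum>i<n. X i \<omega>)" for n
    have top: "filterlim floor_sqrt at_top sequentially"
      unfolding filterlim_at_top eventually_sequentially
    proof (intro allI exI impI)
      fix Z n :: nat assume "Z\<^sup>2 \<le> n"
      then show "Z \<le> floor_sqrt n" by (simp add: le_floor_sqrt_iff)
    qed
    \<comment> \<open>With \<open>k = floor_sqrt n\<close>, the sum splits at
      \<open>k\<^sup>2\<close>; then
      \<open>(a + b)\<^sup>2 \<le> 2 * (a\<^sup>2 + b\<^sup>2)\<close> and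
      \<open>k ^ 4 \<le> n\<^sup>2\<close> apply.\<close>
    have le: "(S n / real n)\<^sup>2 \<le> 2 * (T (floor_sqrt n) \<omega> / real (floor_sqrt n) ^ 4)" if "n > 0" for n
    proof -
      define k where "k = floor_sqrt n"
      define j where "j = n - k\<^sup>2"
      have k: "k > 0" "k\<^sup>2 \<le> n" "n < (Suc k)\<^sup>2"
        using that by (auto simp: k_def Suc_floor_sqrt_power2_gt)
      have n: "n = k\<^sup>2 + j" using k by (simp add: j_def)
      have j: "j \<le> 2 * k" using k(3) unfolding n by (simp add: power2_eq_square)
      define B where "B = (\<Sum>i\<in>{k\<^sup>2..<k\<^sup>2 + j}. X i \<omega>)"
      have "{..<n} = {..<k\<^sup>2} \<union> {k\<^sup>2..<k\<^sup>2 + j}" unfolding n by auto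
      then have S: "S n = S (k\<^sup>2) + B"
        unfolding S_def B_def by (simp add: sum.union_disjoint ivl_disj_int)
      have "B\<^sup>2 \<le> (\<Sum>j\<le>2 * k. (\<Sum>i\<in>{k\<^sup>2..<k\<^sup>2 + j}. X i \<omega>)\<^sup>2)"
        unfolding B_def by (rule member_le_sum) (use j in auto)
      then have ST: "(S (k\<^sup>2))\<^sup>2 + B\<^sup>2 \<le> T k \<omega>" by (simp add: T_def S_def)
      have "(S n)\<^sup>2 \<le> 2 * ((S (k\<^sup>2))\<^sup>2 + B\<^sup>2)"
        unfolding S using sum_squares_bound[of "S (k\<^sup>2)" B] by (simp add: power2_sum)
      also have "\<dots> \<le> 2 * T k \<omega>" by (rule mult_left_mono[OF ST]) simp
      finally have "(S n)\<^sup>2 \<le> 2 * T k \<omega>" .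
      moreover have "real k ^ 4 \<le> (real n)\<^sup>2"
      proof -
        have "real (k\<^sup>2) \<le> real n" using k(2) by (rule of_nat_mono)
        then have "(real (k\<^sup>2))\<^sup>2 \<le> (real n)\<^sup>2" by (rule power_mono) simp
        then show ?thesis by (simp flip: power_mult)
      qed
      ultimately have "(S n)\<^sup>2 / (real n)\<^sup>2 \<le> 2 * T k \<omega> / real k ^ 4"
        using k(1) T_nonneg[of k \<omega>] by (intro frac_le) auto
      then show ?thesis by (simp add: power_divide k_def)
    qed
    have lim: "(\<lambda>n. 2 * (T (floor_sqrt n) \<omega> / real (floor_sqrt n) ^ 4)) \<longlonglongrightarrow> 2 * 0"
      by (intro tendsto_mult tendsto_const filterlim_compose[OF elim top])
    have "(\<lambda>n. (S n / real n)\<^sup>2) \<longlonglongrightarrow> 0"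
    proof (rule Lim_null_comparison)
      show "\<forall>\<^sub>F n in sequentially. norm ((S n / real n)\<^sup>2)
          \<le> 2 * (T (floor_sqrt n) \<omega> / real (floor_sqrt n) ^ 4)"
        using eventually_gt_at_top[of 0] by eventually_elim (use le in simp)
    qed (use lim in simp)
    then have "(\<lambda>n. sqrt ((S n / real n)\<^sup>2)) \<longlonglongrightarrow> sqrt 0" by (rule tendsto_real_sqrt)
    then have "(\<lambda>n. S n / real n) \<longlonglongrightarrow> 0"
      unfolding real_sqrt_abs real_sqrt_zero by (rule tendsto_rabs_zero_cancel)
    then show ?case by (simp add: S_def)
  qed
qed

end

section \<open>The freshest decodable symbol\<close>

text \<open>\<open>G\<close> is the number of generated symbols and \<open>e\<close> the erasure
  pattern. The value is \<open>G\<close> at the last unerased use; it is 0, the index that stands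
  for no output, if all uses are erased.\<close>

primrec freshest :: "(nat \<Rightarrow> nat) \<Rightarrow> (nat \<Rightarrow> bool) \<Rightarrow> nat \<Rightarrow> nat" where
  "freshest G e 0 = 0"
| "freshest G e (Suc i) = (if e (Suc i) then freshest G e i else G (Suc i))"

lemma freshest_cong:
  assumes "\<And>j. j \<in> {1..i} \<Longrightarrow> e j = e' j"
  shows "freshest G e i = freshest G e' i"
  using assms by (induction i) auto

lemma freshest_le: "mono G \<Longrightarrow> freshest G e i \<le> G i"
  by (induction i) (auto dest: monoD[of G _ "Suc _"] intro: order_trans simp: mono_iff_le_Suc)

lemma le_freshest:
  assumes "mono G" "j \<in> {1..i}" "\<not> e j"
  shows "G j \<le> freshest G e i"
  using assms(2)
proof (induction i)
  case (Suc i)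
  show ?case
  proof (cases "e (Suc i)")
    case True
    then have "j \<in> {1..i}" using Suc.prems assms(3) by (cases "j = Suc i") auto
    then show ?thesis using Suc.IH True by simp
  next
    case False
    then show ?thesis using Suc.prems monoD[OF assms(1), of j "Suc i"] by simp
  qed
qed simp

lemma freshest_eq_0_or_unerased:
  "freshest G e i = 0 \<or> (\<exists>j\<in>{1..i}. \<not> e j \<and> freshest G e i = G j)"
proof (induction i)
  case (Suc i) then show ?case by (cases "e (Suc i)") force+
qed simp

lemma ex_neq_if_card_ge_2:
  assumes "CARD('a) \<ge> 2"
  shows "\<exists>x :: 'a. x \<noteq> u"
proof (rule ccontr)
  assume "\<nexists>x. x \<noteq> u"
  then have "(UNIV :: 'a set) = {u}" by auto
  then have "CARD('a) = card {u}" by (rule arg_cong)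
  then show False using assms by simp
qed

lemma length_source_word [simp]: "length (source_word U n \<omega>) = n"
  by (simp add: source_word_def)

lemma take_source_word: "n \<le> m \<Longrightarrow> take n (source_word U m \<omega>) = source_word U n \<omega>"
  by (simp add: source_word_def take_map del: upt_Suc)

lemma nth_source_word: "m \<in> {1..n} \<Longrightarrow> source_word U n \<omega> ! (m - 1) = U m \<omega>"
  by (auto simp: source_word_def simp del: upt_Suc)

lemma length_channel_outputs [simp]: "length (channel_outputs Tc Ts t0 U E f i \<omega>) = i"
  by (simp add: channel_outputs_def)

lemma nth_channel_outputs:
  "j \<in> {1..i} \<Longrightarrow> channel_outputs Tc Ts t0 U E f i \<omega> ! (j - 1) = channel_output Tc Ts t0 U E f j \<omega>"
  by (auto simp: channel_outputs_def simp del: upt_Suc)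

locale timing =
  fixes Tc Ts t0 :: real
  assumes Tc_pos: "Tc > 0" and Ts_pos: "Ts > 0"
begin

abbreviation "G \<equiv> num_generated Tc Ts t0"

lemma mono_num_generated: "mono G"
  unfolding num_generated_def
  by (intro monoI nat_mono floor_mono divide_right_mono diff_right_mono mult_right_mono)
    (use Tc_pos Ts_pos in auto)

lemma num_generated_le: "i \<le> j \<Longrightarrow> G i \<le> G j"
  using mono_num_generated by (rule monoD)

text \<open>Supplies the existence half of \<open>determines\<close> and forces every determined
  symbol to be the true one.\<close>

lemma consistent_source_word:
  "consistent_word Tc Ts t0 f i (channel_outputs Tc Ts t0 U E f i \<omega>) (source_word U (G i) \<omega>)"
  unfolding consistent_word_def
proof (intro conjI ballI)
  fix j assume j: "j \<in> {1..i}"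
  then have "take (G j) (source_word U (G i) \<omega>) = source_word U (G j) \<omega>"
    by (intro take_source_word num_generated_le) simp
  then show "channel_outputs Tc Ts t0 U E f i \<omega> ! (j - 1) = None \<or>
      channel_outputs Tc Ts t0 U E f i \<omega> ! (j - 1) = Some (f j (take (G j) (source_word U (G i) \<omega>)))"
    unfolding nth_channel_outputs[OF j] by (simp add: channel_output_def)
qed simp

text \<open>Every unerased input is computed from a prefix that ends no later than the freshest
  symbol, so it cannot notice a change beyond that point.\<close>

lemma consistent_list_update:
  assumes w: "consistent_word Tc Ts t0 f i (channel_outputs Tc Ts t0 U E f i \<omega>) w"
    and m: "freshest G (\<lambda>j. E j \<omega>) i < m"
  shows "consistent_word Tc Ts t0 f i (channel_outputs Tc Ts t0 U E f i \<omega>) (w[m - 1 := x])"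
  unfolding consistent_word_def
proof (intro conjI ballI)
  show "length (w[m - 1 := x]) = G i" using w by (simp add: consistent_word_def)
  fix j assume j: "j \<in> {1..i}"
  show "channel_outputs Tc Ts t0 U E f i \<omega> ! (j - 1) = None \<or>
      channel_outputs Tc Ts t0 U E f i \<omega> ! (j - 1) = Some (f j (take (G j) (w[m - 1 := x])))"
  proof (cases "E j \<omega>")
    case False
    then have "G j \<le> m - 1"
      using le_freshest[of G j i "\<lambda>j. E j \<omega>"] mono_num_generated j m by simp
    then have "take (G j) (w[m - 1 := x]) = take (G j) w" by (rule take_update_cancel)
    then show ?thesis using w j by (simp add: consistent_word_def)
  qed (unfold nth_channel_outputs[OF j], simp add: channel_output_def)
qed

text \<open>A newer symbol could be replaced by a second letter of the alphabet without
  contradicting the channel outputs.\<close>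

lemma determines_le_freshest:
  fixes f :: "nat \<Rightarrow> 'a::finite list \<Rightarrow> 'v"
  assumes card: "CARD('a) \<ge> 2"
    and m: "m \<in> {1..G i}" and det: "determines Tc Ts t0 f i (channel_outputs Tc Ts t0 U E f i \<omega>) m u"
  shows "m \<le> freshest G (\<lambda>j. E j \<omega>) i"
proof (rule ccontr)
  assume "\<not> m \<le> freshest G (\<lambda>j. E j \<omega>) i"
  then have less: "freshest G (\<lambda>j. E j \<omega>) i < m" by simp
  obtain x where x: "x \<noteq> u"
    using ex_neq_if_card_ge_2[OF card] by blast
  let ?w = "source_word U (G i) \<omega>"
  have "?w[m - 1 := x] ! (m - 1) = u"
    using det consistent_list_update[OF consistent_source_word[of f i U E \<omega>] less, of x]
    unfolding determines_def by blast
  moreover have "m - 1 < length ?w" using m by auto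
  ultimately show False using x nth_list_update_eq by metis
qed

lemma determines_source_symbol:
  assumes "m \<in> {1..G i}" "determines Tc Ts t0 f i (channel_outputs Tc Ts t0 U E f i \<omega>) m u"
  shows "u = U m \<omega>"
  using assms consistent_source_word[of f i U E \<omega>] nth_source_word[of m "G i" U \<omega>]
  unfolding determines_def by metis

text \<open>The \<open>THE\<close> is meaningful because \<open>determines\<close> includes the
  existence of a consistent word, which makes the determined letter unique.\<close>

lemma age_optimal_decoder_SomeD:
  assumes "age_optimal_decoder Tc Ts t0 f i z = Some (u, m)"
  shows "m \<in> {1..G i}" and "determines Tc Ts t0 f i z m u"
proof -
  define S where "S = {m \<in> {1..G i}. \<exists>u. determines Tc Ts t0 f i z m u}"
  have S: "S \<noteq> {}" "u = (THE u. determines Tc Ts t0 f i z m u)" "m = Max S"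
    using assms by (auto simp: age_optimal_decoder_def Let_def S_def split: if_splits)
  have "finite S" by (simp add: S_def)
  then have "m \<in> S" using S by simp
  then obtain u' where m: "m \<in> {1..G i}" and u': "determines Tc Ts t0 f i z m u'"
    by (auto simp: S_def)
  have "u = u'"
    unfolding S(2) by (rule the_equality) (use u' in \<open>auto simp: determines_def\<close>)
  with m u' show "m \<in> {1..G i}" "determines Tc Ts t0 f i z m u" by auto
qed

text \<open>Correctness holds at every sample point and for arbitrary encoders, since a determined
  symbol is the true one.\<close>

lemma valid_scheme_age_optimal:
  fixes f :: "nat \<Rightarrow> 'u list \<Rightarrow> 'v"
  shows
  "valid_scheme M Tc Ts t0 U E \<lparr>enc = f, dec = age_optimal_decoder Tc Ts t0 f\<rparr>"
  unfolding valid_scheme_def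
proof (intro conjI allI impI AE_I2)
  fix i u m and z :: "'v option list"
  assume "dec \<lparr>enc = f, dec = age_optimal_decoder Tc Ts t0 f\<rparr> i z = Some (u, m)"
  then show "m \<in> {1..G i}" using age_optimal_decoder_SomeD(1)[of f i z u m] by simp
next
  fix i \<omega> u m
  assume "dec \<lparr>enc = f, dec = age_optimal_decoder Tc Ts t0 f\<rparr> i
    (channel_outputs Tc Ts t0 U E (enc \<lparr>enc = f, dec = age_optimal_decoder Tc Ts t0 f\<rparr>) i \<omega>)
    = Some (u, m)"
  then show "u = U m \<omega>"
    using age_optimal_decoder_SomeD[of f i "channel_outputs Tc Ts t0 U E f i \<omega>" u m]
      determines_source_symbol[of m i f U E \<omega> u] by simp
qed

text \<open>Nothing newer than \<open>freshest\<close> is determined. Conversely, the input at the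
  last unerased use is itself the newest symbol of that time, so all consistent words agree on
  it.\<close>

lemma decoded_index_lcfs:
  fixes f :: "nat \<Rightarrow> 'a::finite list \<Rightarrow> 'a"
  assumes card: "CARD('a) \<ge> 2"
    and f: "\<And>i w. i \<ge> 1 \<Longrightarrow> G i \<ge> 1 \<Longrightarrow> length w = G i \<Longrightarrow> f i w = last w"
  shows "decoded_index Tc Ts t0 U E \<lparr>enc = f, dec = age_optimal_decoder Tc Ts t0 f\<rparr> i \<omega>
    = freshest G (\<lambda>j. E j \<omega>) i"
proof (cases "i = 0")
  case False
  let ?z = "channel_outputs Tc Ts t0 U E f i \<omega>"
  let ?n = "freshest G (\<lambda>j. E j \<omega>) i"
  define S where "S = {m \<in> {1..G i}. \<exists>u. determines Tc Ts t0 f i ?z m u}"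
  have dec: "age_optimal_decoder Tc Ts t0 f i ?z =
      (if S = {} then None else Some (THE u. determines Tc Ts t0 f i ?z (Max S) u, Max S))"
    by (simp only: age_optimal_decoder_def Let_def S_def)
  have le: "m \<le> ?n" if "m \<in> S" for m
    using that determines_le_freshest[OF card, of m i f U E \<omega>] unfolding S_def by blast
  have mem: "?n \<in> S" if pos: "?n > 0"
  proof -
    obtain j where j: "j \<in> {1..i}" "\<not> E j \<omega>" "?n = G j"
      using freshest_eq_0_or_unerased[of G "\<lambda>j. E j \<omega>" i] pos by auto
    have len: "G j \<le> G i" using j by (intro num_generated_le) simp
    \<comment> \<open>The input received at use \<open>j\<close> is the last letter of the prefix of
      length \<open>G j\<close>, that is, symbol number \<open>G j\<close> at list position
      \<open>G j - 1\<close>.\<close>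
    have "determines Tc Ts t0 f i ?z (G j) (f j (source_word U (G j) \<omega>))"
      unfolding determines_def
    proof (intro conjI allI impI exI)
      show "consistent_word Tc Ts t0 f i ?z (source_word U (G i) \<omega>)"
        by (rule consistent_source_word)
      fix w assume w: "consistent_word Tc Ts t0 f i ?z w"
      then have lw: "length (take (G j) w) = G j" using len by (simp add: consistent_word_def)
      have "?z ! (j - 1) = None \<or> ?z ! (j - 1) = Some (f j (take (G j) w))"
        using w j(1) unfolding consistent_word_def by blast
      then have "f j (source_word U (G j) \<omega>) = f j (take (G j) w)"
        using j(2) unfolding nth_channel_outputs[OF j(1)] by (simp add: channel_output_def)
      also have "\<dots> = last (take (G j) w)" using f[of j "take (G j) w"] j pos lw by simp
      also have "\<dots> = take (G j) w ! (G j - 1)"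
        using lw j pos by (subst last_conv_nth) auto
      also have "\<dots> = w ! (G j - 1)" using j pos by simp
      finally show "w ! (G j - 1) = f j (source_word U (G j) \<omega>)" by simp
    qed
    then show ?thesis using j pos len by (auto simp: S_def)
  qed
  show ?thesis
  proof (cases "?n = 0")
    case True
    \<comment> \<open>Members of \<open>S\<close> are at least 1, so a freshest index of 0 leaves
      none; the decoder then outputs ERASURE, which also counts as index 0.\<close>
    then have "S = {}" using le by (force simp: S_def)
    then show ?thesis using True \<open>i \<noteq> 0\<close> by (simp add: decoded_index_def dec)
  next
    case False
    then have "?n \<in> S" using mem by simp
    then have "S \<noteq> {}" "Max S = ?n" using le by (auto intro!: Max_eqI simp: S_def)
    then show ?thesis using \<open>i \<noteq> 0\<close> by (simp add: decoded_index_def dec)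
  qed
qed (simp add: decoded_index_def)

end

section \<open>Probabilities of source words and erasure patterns\<close>

lemma sets_PiM_Collect_finite_eq:
  assumes "finite J" "J \<subseteq> I"
  shows "{x \<in> space (Pi\<^sub>M I (\<lambda>_. count_space UNIV)). \<forall>j\<in>J. x j = c j} \<in> sets (Pi\<^sub>M I (\<lambda>_. count_space UNIV))"
proof (intro sets.sets_Collect_finite_All assms(1))
  fix j assume "j \<in> J"
  then have "(\<lambda>x. x j) \<in> measurable (Pi\<^sub>M I (\<lambda>_. count_space UNIV)) (count_space UNIV)"
    using assms(2) by (intro measurable_component_singleton) auto
  from measurable_sets[OF this, of "{c j}"]
  show "{x \<in> space (Pi\<^sub>M I (\<lambda>_. count_space UNIV)). x j = c j} \<in> sets (Pi\<^sub>M I (\<lambda>_. count_space UNIV))"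
    by (simp add: vimage_def Int_def conj_commute)
qed

lemma source_word_eq_iff:
  "length w = n \<Longrightarrow> source_word U n \<omega> = w \<longleftrightarrow> (\<forall>m\<in>{1..n}. U m \<omega> = w ! (m - 1))"
proof -
  assume n: "length w = n"
  have "source_word U n \<omega> = w \<longleftrightarrow> (\<forall>k<n. U (Suc k) \<omega> = w ! k)"
    using n by (auto simp: list_eq_iff_nth_eq source_word_def simp del: upt_Suc)
  also have "\<dots> \<longleftrightarrow> (\<forall>m\<in>{1..n}. U m \<omega> = w ! (m - 1))"
  proof (intro iffI ballI allI impI)
    fix m assume "\<forall>k<n. U (Suc k) \<omega> = w ! k" "m \<in> {1..n}"
    then show "U m \<omega> = w ! (m - 1)" by (cases m) auto
  next
    fix k assume "\<forall>m\<in>{1..n}. U m \<omega> = w ! (m - 1)" "k < n"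
    then show "U (Suc k) \<omega> = w ! k" by (auto dest: bspec[of _ _ "Suc k"])
  qed
  finally show ?thesis .
qed

context prob_space
begin

lemma prob_pos_AE_witness:
  assumes "A \<in> events" "prob A > 0" "AE \<omega> in M. P \<omega>"
  obtains \<omega> where "\<omega> \<in> A" "P \<omega>"
proof -
  have "\<exists>\<omega>\<in>A. P \<omega>"
  proof (rule ccontr)
    assume "\<not> (\<exists>\<omega>\<in>A. P \<omega>)"
    then have "AE \<omega> in M. \<omega> \<notin> A" using assms(3) by (auto elim: eventually_mono)
    then show False using assms(1,2) prob_eq_0[of A] by simp
  qed
  then show thesis using that by blast
qed

text \<open>The probability is a product of positive letter probabilities. The empty word is
  separate because the product rule for independent variables is applied to a nonempty index
  set.\<close>

lemma prob_source_word_pos: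
  assumes U: "memoryless_source M U" and w: "length w = n"
  shows "prob {\<omega> \<in> space M. source_word U n \<omega> = w} > 0"
proof (cases "n = 0")
  case True
  then show ?thesis using w by (simp add: source_word_def prob_space)
next
  case False
  obtain p where ind: "indep_vars (\<lambda>_. count_space UNIV) U {1..}"
    and p: "\<And>u. pmf p u > 0" "\<And>m. m \<ge> 1 \<Longrightarrow> distr M (count_space UNIV) (U m) = measure_pmf p"
    using U unfolding memoryless_source_def by blast
  have rv: "random_variable (count_space UNIV) (U m)" if "m \<ge> 1" for m
    using ind that by (auto simp: indep_vars_def)
  have "{\<omega> \<in> space M. source_word U n \<omega> = w} = (\<Inter>m\<in>{1..n}. U m -` {w ! (m - 1)} \<inter> space M)"
    using False by (auto simp: source_word_eq_iff[OF w])
  also have "prob \<dots> = (\<Prod>m\<in>{1..n}. prob (U m -` {w ! (m - 1)} \<inter> space M))"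
    using False by (intro indep_varsD[OF ind]) auto
  also have "\<dots> > 0"
  proof (rule prod_pos)
    fix m assume m: "m \<in> {1..n}"
    then have "prob (U m -` {w ! (m - 1)} \<inter> space M) = measure (distr M (count_space UNIV) (U m)) {w ! (m - 1)}"
      by (intro measure_distr[symmetric] rv) auto
    also have "\<dots> = pmf p (w ! (m - 1))" using p(2)[of m] m by (simp add: measure_pmf_single)
    finally show "0 < prob (U m -` {w ! (m - 1)} \<inter> space M)" using p(1) by simp
  qed
  finally show ?thesis .
qed

lemma events_erasure_pattern:
  assumes "indep_vars (\<lambda>_. count_space UNIV) E {1..}"
  shows "{\<omega> \<in> space M. \<forall>j\<in>{1..i::nat}. E j \<omega> = e j} \<in> events"
proof (rule sets.sets_Collect_finite_All)
  fix j :: nat assume "j \<in> {1..i}"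
  then have "random_variable (count_space UNIV) (E j)" using assms by (auto simp: indep_vars_def)
  from measurable_sets[OF this, of "{e j}"]
  show "{\<omega> \<in> space M. E j \<omega> = e j} \<in> events" by (simp add: vimage_def Int_def conj_commute)
qed simp

text \<open>There are finitely many patterns of length \<open>i\<close>, so those of probability
  zero together form a null set.\<close>

lemma AE_prob_erasure_pattern_pos:
  fixes E :: "nat \<Rightarrow> 'a \<Rightarrow> bool"
  assumes ind: "indep_vars (\<lambda>_. count_space UNIV) E {1..}"
  shows "AE \<omega> in M. prob {\<omega>' \<in> space M. \<forall>j\<in>{1..i}. E j \<omega>' = E j \<omega>} > 0"
proof -
  \<comment> \<open>Patterns are encoded as sets of erased positions, so that they range over the
    finite set \<open>Pow {1..i}\<close>.\<close>
  define A where "A e = {\<omega>' \<in> space M. \<forall>j\<in>{1..i}. E j \<omega>' = (j \<in> e)}" for e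
  have A: "A e \<in> events" for e unfolding A_def by (rule events_erasure_pattern[OF ind])
  have "AE \<omega> in M. \<omega> \<in> A e \<longrightarrow> prob (A e) > 0" for e
  proof (cases "prob (A e) = 0")
    case True
    then have "AE \<omega> in M. \<omega> \<notin> A e" using prob_eq_0[OF A] by simp
    then show ?thesis by eventually_elim simp
  qed (simp add: zero_less_measure_iff)
  then have "AE \<omega> in M. \<forall>e\<in>Pow {1..i}. \<omega> \<in> A e \<longrightarrow> prob (A e) > 0"
    by (subst AE_ball_countable) (auto intro: countable_finite)
  then show ?thesis
    using AE_space
  proof eventually_elim
    case (elim \<omega>)
    define e where "e = {j \<in> {1..i}. E j \<omega>}"
    have "A e = {\<omega>' \<in> space M. \<forall>j\<in>{1..i}. E j \<omega>' = E j \<omega>}" by (auto simp: A_def e_def)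
    moreover have "\<omega> \<in> A e" using elim(2) by (auto simp: A_def e_def)
    ultimately show ?case using elim(1) by (auto simp: e_def)
  qed
qed

text \<open>Both events are preimages of cylinder sets with finitely many fixed coordinates, hence
  members of the two independent families.\<close>

lemma prob_source_word_erasure_pattern:
  assumes ind: "source_indep_erasures M U E" and w: "length w = n"
  shows "prob ({\<omega> \<in> space M. source_word U n \<omega> = w} \<inter> {\<omega> \<in> space M. \<forall>j\<in>{1..i}. E j \<omega> = e j})
    = prob {\<omega> \<in> space M. source_word U n \<omega> = w} * prob {\<omega> \<in> space M. \<forall>j\<in>{1..i}. E j \<omega> = e j}"
proof (rule indep_setD)
  show "indep_set
       {(\<lambda>\<omega>. \<lambda>m\<in>{1..}. U m \<omega>) -` A \<inter> space M |A. A \<in> sets (Pi\<^sub>M {1..} (\<lambda>_. count_space UNIV))}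
       {(\<lambda>\<omega>. \<lambda>i\<in>{1..}. E i \<omega>) -` B \<inter> space M |B. B \<in> sets (Pi\<^sub>M {1..} (\<lambda>_. count_space UNIV))}"
    using ind unfolding source_indep_erasures_def .
  have "{\<omega> \<in> space M. source_word U n \<omega> = w} = (\<lambda>\<omega>. \<lambda>m\<in>{1..}. U m \<omega>) -`
      {x \<in> space (Pi\<^sub>M {1..} (\<lambda>_. count_space UNIV)). \<forall>m\<in>{1..n}. x m = w ! (m - 1)} \<inter> space M"
    by (auto simp: source_word_eq_iff[OF w] space_PiM)
  then show "{\<omega> \<in> space M. source_word U n \<omega> = w} \<in>
      {(\<lambda>\<omega>. \<lambda>m\<in>{1..}. U m \<omega>) -` A \<inter> space M |A. A \<in> sets (Pi\<^sub>M {1..} (\<lambda>_. count_space UNIV))}"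
    by (intro CollectI exI conjI) (assumption, rule sets_PiM_Collect_finite_eq, auto)
  have "{\<omega> \<in> space M. \<forall>j\<in>{1..i}. E j \<omega> = e j} = (\<lambda>\<omega>. \<lambda>j\<in>{1..}. E j \<omega>) -`
      {x \<in> space (Pi\<^sub>M {1..} (\<lambda>_. count_space UNIV)). \<forall>j\<in>{1..i}. x j = e j} \<inter> space M"
    by (auto simp: space_PiM)
  then show "{\<omega> \<in> space M. \<forall>j\<in>{1..i}. E j \<omega> = e j} \<in>
      {(\<lambda>\<omega>. \<lambda>i\<in>{1..}. E i \<omega>) -` B \<inter> space M |B. B \<in> sets (Pi\<^sub>M {1..} (\<lambda>_. count_space UNIV))}"
    by (intro CollectI exI conjI) (assumption, rule sets_PiM_Collect_finite_eq, auto)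
qed

end

section \<open>Converse bound for arbitrary valid schemes\<close>

context timing
begin

text \<open>If a decoder output a symbol newer than the last unerased input, that symbol could be changed
  without affecting the channel outputs; the changed source word has positive probability under the
  same erasure pattern, so the decoder would err.\<close>

lemma AE_decoded_index_le_freshest:
  fixes C :: "('u::finite, 'v) coding_scheme"
  assumes "prob_space M" and card: "CARD('u) \<ge> 2"
    and U: "memoryless_source M U"
    and E: "prob_space.indep_vars M (\<lambda>_. count_space UNIV) E {1..}"
    and ind: "source_indep_erasures M U E"
    and valid: "valid_scheme M Tc Ts t0 U E C"
  shows "AE \<omega> in M. \<forall>i. decoded_index Tc Ts t0 U E C i \<omega> \<le> freshest G (\<lambda>j. E j \<omega>) i"
proof -
  interpret prob_space M by fact
  have "AE \<omega> in M. decoded_index Tc Ts t0 U E C i \<omega> \<le> freshest G (\<lambda>j. E j \<omega>) i" for i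
  proof (cases "i = 0")
    case False
    let ?z = "channel_outputs Tc Ts t0 U E (enc C) i"
    have V: "AE \<omega> in M. \<forall>u m. dec C i (?z \<omega>) = Some (u, m) \<longrightarrow> u = U m \<omega>"
      using valid False by (simp add: valid_scheme_def)
    show ?thesis
      using AE_prob_erasure_pattern_pos[OF E, of i]
    proof eventually_elim
      case (elim \<omega>)
      show ?case
      proof (rule ccontr)
        assume "\<not> ?thesis"
        then obtain u m where d: "dec C i (?z \<omega>) = Some (u, m)"
          and less: "freshest G (\<lambda>j. E j \<omega>) i < m"
          using False by (auto simp: decoded_index_def split: option.splits)
        have m: "m \<in> {1..G i}"
        proof -
          have "\<forall>i\<ge>1. \<forall>z u m. length z = i \<longrightarrow> dec C i z = Some (u, m) \<longrightarrow> m \<in> {1..G i}"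
            using valid unfolding valid_scheme_def by blast
          then show ?thesis using d False length_channel_outputs by (meson less_one not_le)
        qed
        obtain x where x: "x \<noteq> u" using ex_neq_if_card_ge_2[OF card] by blast
        \<comment> \<open>The alternative source word differs from the true one only in symbol
          \<open>m\<close>, where it contradicts the decoder output.\<close>
        define w where "w = (source_word U (G i) \<omega>)[m - 1 := x]"
        have w: "length w = G i" by (simp add: w_def)
        let ?W = "{\<omega>' \<in> space M. source_word U (G i) \<omega>' = w}"
        let ?P = "{\<omega>' \<in> space M. \<forall>j\<in>{1..i}. E j \<omega>' = E j \<omega>}"
        have pos: "prob (?W \<inter> ?P) > 0"
          using elim prob_source_word_pos[OF U w]
          by (simp only: prob_source_word_erasure_pattern[OF ind w] mult_pos_pos)
        \<comment> \<open>A set outside the sigma-algebra has measure 0 by convention, so positive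
          probability already yields measurability.\<close>
        have "?W \<inter> ?P \<in> events"
        proof (rule ccontr)
          assume "?W \<inter> ?P \<notin> events"
          then have "prob (?W \<inter> ?P) = 0" by (rule measure_notin_sets)
          then show False using pos by simp
        qed
        then obtain \<omega>' where mem: "\<omega>' \<in> ?W \<inter> ?P"
          and v': "\<forall>u m. dec C i (?z \<omega>') = Some (u, m) \<longrightarrow> u = U m \<omega>'"
          by (rule prob_pos_AE_witness[OF _ pos V])
        then have w': "source_word U (G i) \<omega>' = w"
          and e': "\<And>j. j \<in> {1..i} \<Longrightarrow> E j \<omega>' = E j \<omega>" by auto
        have "channel_output Tc Ts t0 U E (enc C) j \<omega>' = channel_output Tc Ts t0 U E (enc C) j \<omega>"
          if j: "j \<in> {1..i}" for j
        proof (cases "E j \<omega>")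
          case True
          then show ?thesis using e'[OF j] by (simp add: channel_output_def)
        next
          case False
          have le: "G j \<le> G i" using j by (intro num_generated_le) simp
          have "G j \<le> m - 1"
            using le_freshest[of G j i "\<lambda>j. E j \<omega>"] mono_num_generated j False less by simp
          have "source_word U (G j) \<omega>' = take (G j) w"
            using take_source_word[OF le] w' by metis
          also have "\<dots> = take (G j) (source_word U (G i) \<omega>)"
            unfolding w_def using \<open>G j \<le> m - 1\<close> by (rule take_update_cancel)
          also have "\<dots> = source_word U (G j) \<omega>" by (rule take_source_word[OF le])
          finally show ?thesis using e'[OF j] by (simp add: channel_output_def)
        qed
        then have "?z \<omega>' = ?z \<omega>" by (simp add: channel_outputs_def del: upt_Suc)
        then have "u = U m \<omega>'" using v' d by simp
        also have "\<dots> = w ! (m - 1)" using nth_source_word[OF m, of U \<omega>'] w' by simp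
        also have "\<dots> = x" unfolding w_def by (rule nth_list_update_eq) (use m in auto)
        finally show False using x by simp
      qed
    qed
  qed (simp add: decoded_index_def)
  then show ?thesis by (simp add: AE_all_countable)
qed

end

section \<open>The mean lag of the freshest symbol\<close>

lemma measurable_freshest:
  assumes "{1..i} \<subseteq> I"
  shows "(\<lambda>x. freshest G x i) \<in> measurable (Pi\<^sub>M I (\<lambda>_. count_space UNIV)) (count_space UNIV)"
  using assms
proof (induction i)
  case (Suc i)
  have IH: "(\<lambda>x. freshest G x i) \<in> measurable (Pi\<^sub>M I (\<lambda>_. count_space UNIV)) (count_space UNIV)"
    using Suc.prems by (intro Suc.IH) auto
  have "(\<lambda>x. x (Suc i)) \<in> measurable (Pi\<^sub>M I (\<lambda>_. count_space UNIV :: bool measure)) (count_space UNIV)"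
    using Suc.prems by (intro measurable_component_singleton) auto
  then show ?case
    unfolding freshest.simps by (intro measurable_If IH measurable_const) (auto simp: pred_def[symmetric])
qed simp

context prob_space
begin

text \<open>The next erasure is independent of every function \<open>H\<close> of the first
  \<open>i\<close> ones; boundedness of \<open>H\<close> gives integrability. All moment
  computations for the lag rest on this factorization.\<close>

lemma expectation_erasure_mult:
  fixes E :: "nat \<Rightarrow> 'a \<Rightarrow> bool"
  assumes ind: "indep_vars (\<lambda>_. count_space UNIV) E {1..}"
    and prob: "\<And>j. j \<ge> 1 \<Longrightarrow> prob {\<omega> \<in> space M. E j \<omega>} = \<epsilon>"
    and H: "H \<in> borel_measurable (Pi\<^sub>M {1..i} (\<lambda>_. count_space UNIV))"
    and B: "\<And>x. \<bar>H x\<bar> \<le> B"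
  shows "integrable M (\<lambda>\<omega>. H (\<lambda>j\<in>{1..i}. E j \<omega>))"
    and "integrable M (\<lambda>\<omega>. of_bool (E (Suc i) \<omega>) * H (\<lambda>j\<in>{1..i}. E j \<omega>))"
    and "expectation (\<lambda>\<omega>. of_bool (E (Suc i) \<omega>) * H (\<lambda>j\<in>{1..i}. E j \<omega>))
      = \<epsilon> * expectation (\<lambda>\<omega>. H (\<lambda>j\<in>{1..i}. E j \<omega>))"
proof -
  let ?P = "\<lambda>J. Pi\<^sub>M J (\<lambda>_. count_space UNIV :: bool measure)"
  have rv: "random_variable (count_space UNIV) (E j)" if "j \<ge> 1" for j
    using ind that by (auto simp: indep_vars_def)
  have "(\<lambda>x. x (Suc i)) \<in> measurable (?P {Suc i}) (count_space UNIV)"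
    by (intro measurable_component_singleton) simp
  then have Y: "(\<lambda>x. of_bool (x (Suc i)) :: real) \<in> borel_measurable (?P {Suc i})"
    by (rule measurable_compose) simp
  have "indep_var (?P {Suc i}) (\<lambda>\<omega>. \<lambda>j\<in>{Suc i}. E j \<omega>) (?P {1..i}) (\<lambda>\<omega>. \<lambda>j\<in>{1..i}. E j \<omega>)"
    by (rule indep_var_restrict[OF ind]) auto
  from indep_var_compose[OF this Y H]
  have indep: "indep_var borel (\<lambda>\<omega>. of_bool (E (Suc i) \<omega>) :: real) borel (\<lambda>\<omega>. H (\<lambda>j\<in>{1..i}. E j \<omega>))"
    by (simp add: comp_def)
  have eE: "(\<lambda>\<omega>. of_bool (E (Suc i) \<omega>) :: real) \<in> borel_measurable M"
    by (rule measurable_compose[OF rv]) simp_all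
  have iE: "integrable M (\<lambda>\<omega>. of_bool (E (Suc i) \<omega>) :: real)"
    by (rule integrable_const_bound[where B = 1]) (use eE in auto)
  have "(\<lambda>\<omega>. \<lambda>j\<in>{1..i}. E j \<omega>) \<in> measurable M (?P {1..i})"
    using rv by (intro measurable_restrict) auto
  from measurable_compose[OF this H]
  show iH: "integrable M (\<lambda>\<omega>. H (\<lambda>j\<in>{1..i}. E j \<omega>))"
    by (intro integrable_const_bound[where B = B]) (use B in auto)
  show "integrable M (\<lambda>\<omega>. of_bool (E (Suc i) \<omega>) * H (\<lambda>j\<in>{1..i}. E j \<omega>))"
    by (rule indep_var_integrable[OF indep iE iH])
  have "expectation (\<lambda>\<omega>. of_bool (E (Suc i) \<omega>)) = prob {\<omega> \<in> space M. E (Suc i) \<omega>}"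
  proof -
    have "expectation (\<lambda>\<omega>. of_bool (E (Suc i) \<omega>)) = expectation (indicator {\<omega> \<in> space M. E (Suc i) \<omega>})"
      by (intro Bochner_Integration.integral_cong) (auto simp: indicator_def)
    also have "\<dots> = prob ({\<omega> \<in> space M. E (Suc i) \<omega>} \<inter> space M)"
      by (rule Bochner_Integration.integral_indicator)
    also have "{\<omega> \<in> space M. E (Suc i) \<omega>} \<inter> space M = {\<omega> \<in> space M. E (Suc i) \<omega>}" by auto
    finally show ?thesis .
  qed
  then show "expectation (\<lambda>\<omega>. of_bool (E (Suc i) \<omega>) * H (\<lambda>j\<in>{1..i}. E j \<omega>))
      = \<epsilon> * expectation (\<lambda>\<omega>. H (\<lambda>j\<in>{1..i}. E j \<omega>))"
    using indep_var_lebesgue_integral[OF indep iE iH] prob[of "Suc i"] by simp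
qed

end

text \<open>\<open>c / (1 - \<rho>)\<close> is the fixed point of the recursion, and the
  contribution of the initial value only shrinks.\<close>

lemma affine_recursion_bound:
  fixes x :: "nat \<Rightarrow> real"
  assumes step: "\<And>i. x (Suc i) \<le> \<rho> * x i + c" and \<rho>: "0 \<le> \<rho>" "\<rho> < 1" and nonneg: "0 \<le> x 0" "0 \<le> c"
  shows "x i \<le> x 0 + c / (1 - \<rho>)"
proof (induction i)
  case (Suc i)
  have "x (Suc i) \<le> \<rho> * (x 0 + c / (1 - \<rho>)) + c"
    using step[of i] mult_left_mono[OF Suc.IH \<rho>(1)] by linarith
  also have "\<dots> = \<rho> * x 0 + c / (1 - \<rho>)" using \<rho> by (simp add: field_simps)
  also have "\<dots> \<le> x 0 + c / (1 - \<rho>)" using \<rho> nonneg mult_right_mono[of \<rho> 1 "x 0"] by simp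
  finally show ?case .
qed (use assms in simp)

text \<open>Young's inequality for the cross term. The coefficient of \<open>a\<^sup>2\<close> can
  be kept close to 1, so that it stays below 1 after multiplication by the erasure
  probability.\<close>

lemma square_add_le_weighted:
  fixes a b \<eta> :: real
  assumes "\<eta> > 0"
  shows "(a + b)\<^sup>2 \<le> (1 + \<eta>) * a\<^sup>2 + (1 + 1 / \<eta>) * b\<^sup>2"
proof -
  have "0 \<le> (\<eta> * a - b)\<^sup>2 / \<eta>" using assms by simp
  also have "\<dots> = \<eta> * a\<^sup>2 - 2 * a * b + b\<^sup>2 / \<eta>"
    using assms by (simp add: field_simps power2_eq_square)
  finally show ?thesis by (simp add: power2_eq_square algebra_simps)
qed

section \<open>Moments and long-run mean of the lag\<close>

locale erasure_lag = prob_space M for M :: "'w measure" +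
  fixes E :: "nat \<Rightarrow> 'w \<Rightarrow> bool" and \<epsilon> :: real and G :: "nat \<Rightarrow> nat" and d :: real
  assumes indep_E: "indep_vars (\<lambda>_. count_space UNIV) E {1..}"
    and prob_E: "\<And>j. j \<ge> 1 \<Longrightarrow> prob {\<omega> \<in> space M. E j \<omega>} = \<epsilon>"
    and eps: "0 \<le> \<epsilon>" "\<epsilon> < 1"
    and mono_G: "mono G" and increment: "\<And>i. real (G (Suc i)) - real (G i) \<le> d"
begin

definition lag :: "nat \<Rightarrow> (nat \<Rightarrow> bool) \<Rightarrow> real" where
  "lag i e = real (G i) - real (freshest G e i)"

text \<open>The lag that results at use \<open>Suc i\<close> if that use is erased.\<close>

definition candidate :: "nat \<Rightarrow> (nat \<Rightarrow> bool) \<Rightarrow> real" where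
  "candidate i e = real (G (Suc i)) - real (freshest G e i)"

text \<open>The martingale difference \<open>lag (Suc i)\<close> minus its conditional mean given
  the first \<open>i\<close> erasures, which is \<open>\<epsilon>\<close> times the
  candidate.\<close>

definition innovation :: "nat \<Rightarrow> (nat \<Rightarrow> bool) \<Rightarrow> real" where
  "innovation i e = (of_bool (e (Suc i)) - \<epsilon>) * candidate i e"

abbreviation "erased \<omega> \<equiv> \<lambda>j. E j \<omega>"
abbreviation "erased_upto i \<omega> \<equiv> \<lambda>j\<in>{1..i}. E j \<omega>"

lemma lag_Suc: "lag (Suc i) e = of_bool (e (Suc i)) * candidate i e"
  by (simp add: lag_def candidate_def)

lemma lag_nonneg: "0 \<le> lag i e" and lag_le: "lag i e \<le> real (G i)"
  using freshest_le[OF mono_G, of e i] by (simp_all add: lag_def)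

lemma candidate_bounds: "0 \<le> candidate i e" "candidate i e \<le> real (G (Suc i))" "candidate i e \<le> lag i e + d"
  using freshest_le[OF mono_G, of e i] monoD[OF mono_G, of i "Suc i"] increment[of i]
  by (simp_all add: candidate_def lag_def)

text \<open>Allows the lag and its relatives to be read as functions of the restricted erasure
  sequence, the form in which independence applies.\<close>

lemma freshest_prefix: "j \<le> i \<Longrightarrow> freshest G (erased_upto i \<omega>) j = freshest G (erased \<omega>) j"
  by (rule freshest_cong) auto

lemma measurable_real_freshest:
  "j \<le> i \<Longrightarrow> (\<lambda>x. real (freshest G x j)) \<in> borel_measurable (Pi\<^sub>M {1..i} (\<lambda>_. count_space UNIV))"
  by (rule measurable_compose[OF measurable_freshest]) auto

lemma measurable_lag: "j \<le> i \<Longrightarrow> lag j \<in> borel_measurable (Pi\<^sub>M {1..i} (\<lambda>_. count_space UNIV))"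
  and measurable_candidate: "j \<le> i \<Longrightarrow> candidate j \<in> borel_measurable (Pi\<^sub>M {1..i} (\<lambda>_. count_space UNIV))"
  unfolding lag_def[abs_def] candidate_def[abs_def]
  by (intro borel_measurable_diff borel_measurable_const measurable_real_freshest; assumption)+

lemma measurable_innovation:
  assumes "Suc j \<le> i"
  shows "innovation j \<in> borel_measurable (Pi\<^sub>M {1..i} (\<lambda>_. count_space UNIV))"
proof -
  have "(\<lambda>x. x (Suc j)) \<in> measurable (Pi\<^sub>M {1..i} (\<lambda>_. count_space UNIV :: bool measure)) (count_space UNIV)"
    using assms by (intro measurable_component_singleton) auto
  then have "(\<lambda>x. of_bool (x (Suc j)) :: real) \<in> borel_measurable (Pi\<^sub>M {1..i} (\<lambda>_. count_space UNIV))"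
    by (rule measurable_compose) simp
  then show ?thesis
    unfolding innovation_def[abs_def] using assms
    by (intro borel_measurable_times borel_measurable_diff borel_measurable_const measurable_candidate) auto
qed

lemma lag_prefix: "j \<le> i \<Longrightarrow> lag j (erased_upto i \<omega>) = lag j (erased \<omega>)"
  and candidate_prefix: "j \<le> i \<Longrightarrow> candidate j (erased_upto i \<omega>) = candidate j (erased \<omega>)"
  and innovation_prefix: "Suc j \<le> i \<Longrightarrow> innovation j (erased_upto i \<omega>) = innovation j (erased \<omega>)"
  by (simp_all add: lag_def candidate_def innovation_def freshest_prefix del: One_nat_def)

lemma abs_innovation_le: "\<bar>innovation i e\<bar> \<le> candidate i e"
proof -
  have "\<bar>of_bool (e (Suc i)) - \<epsilon>\<bar> \<le> 1" using eps by simp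
  then have "\<bar>of_bool (e (Suc i)) - \<epsilon>\<bar> * \<bar>candidate i e\<bar> \<le> 1 * \<bar>candidate i e\<bar>"
    by (rule mult_right_mono) simp
  then show ?thesis using candidate_bounds(1)[of i e] by (simp add: innovation_def abs_mult)
qed

lemma candidate_sq_bound: "\<bar>(candidate i e)\<^sup>2\<bar> \<le> (real (G (Suc i)))\<^sup>2"
  using candidate_bounds[of i e] by (simp add: power_mono)

lemma lag_sq_bound: "\<bar>(lag i e)\<^sup>2\<bar> \<le> (real (G i))\<^sup>2"
  using lag_nonneg[of i e] lag_le[of i e] by (simp add: power_mono)

text \<open>For fixed \<open>i\<close> both variables are bounded. The next lag is the candidate
  with conditional probability \<open>\<epsilon>\<close> and 0 otherwise.\<close>

lemma lag_sq_expectation_facts: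
  "integrable M (\<lambda>\<omega>. (lag i (erased \<omega>))\<^sup>2)"
  "integrable M (\<lambda>\<omega>. (candidate i (erased \<omega>))\<^sup>2)"
  "expectation (\<lambda>\<omega>. (lag (Suc i) (erased \<omega>))\<^sup>2) = \<epsilon> * expectation (\<lambda>\<omega>. (candidate i (erased \<omega>))\<^sup>2)"
proof -
  have ml: "(\<lambda>e. (lag i e)\<^sup>2) \<in> borel_measurable (Pi\<^sub>M {1..i} (\<lambda>_. count_space UNIV))"
    by (intro borel_measurable_power measurable_lag order_refl)
  have mc: "(\<lambda>e. (candidate i e)\<^sup>2) \<in> borel_measurable (Pi\<^sub>M {1..i} (\<lambda>_. count_space UNIV))"
    by (intro borel_measurable_power measurable_candidate order_refl)
  show "integrable M (\<lambda>\<omega>. (lag i (erased \<omega>))\<^sup>2)"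
    using expectation_erasure_mult(1)[OF indep_E prob_E ml lag_sq_bound]
    unfolding lag_prefix[OF order_refl] .
  note c = expectation_erasure_mult[OF indep_E prob_E mc candidate_sq_bound,
      unfolded candidate_prefix[OF order_refl]]
  show "integrable M (\<lambda>\<omega>. (candidate i (erased \<omega>))\<^sup>2)" by (rule c(1))
  have "(lag (Suc i) (erased \<omega>))\<^sup>2 = of_bool (E (Suc i) \<omega>) * (candidate i (erased \<omega>))\<^sup>2" for \<omega>
    by (simp add: lag_Suc)
  then show "expectation (\<lambda>\<omega>. (lag (Suc i) (erased \<omega>))\<^sup>2) = \<epsilon> * expectation (\<lambda>\<omega>. (candidate i (erased \<omega>))\<^sup>2)"
    using c(3) by (simp only:)
qed

text \<open>For \<open>j < i\<close> the earlier innovation is a function of the first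
  \<open>i\<close> erasures, whereas the later one has the independent centred factor
  \<open>of_bool (E (Suc i) \<omega>) - \<epsilon>\<close>.\<close>

lemma expectation_innovation_mult:
  assumes "j < i"
  shows "integrable M (\<lambda>\<omega>. innovation i (erased \<omega>) * innovation j (erased \<omega>))"
    and "expectation (\<lambda>\<omega>. innovation i (erased \<omega>) * innovation j (erased \<omega>)) = 0"
proof -
  define H where "H x = candidate i x * innovation j x" for x
  have meas: "H \<in> borel_measurable (Pi\<^sub>M {1..i} (\<lambda>_. count_space UNIV))"
    unfolding H_def[abs_def] using assms
    by (intro borel_measurable_times measurable_candidate measurable_innovation) auto
  have B: "\<bar>H x\<bar> \<le> real (G (Suc i)) * real (G (Suc j))" for x
    unfolding H_def abs_mult
    using candidate_bounds[of i x] candidate_bounds[of j x] abs_innovation_le[of j x]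
    by (intro mult_mono) auto
  note * = expectation_erasure_mult[OF indep_E prob_E meas B]
  have H: "H (erased_upto i \<omega>) = candidate i (erased \<omega>) * innovation j (erased \<omega>)" for \<omega>
    using assms by (simp add: H_def candidate_prefix innovation_prefix del: One_nat_def)
  have eq: "innovation i (erased \<omega>) * innovation j (erased \<omega>)
      = of_bool (E (Suc i) \<omega>) * H (erased_upto i \<omega>) - \<epsilon> * H (erased_upto i \<omega>)" for \<omega>
    unfolding H by (simp add: innovation_def[of i] algebra_simps)
  show "integrable M (\<lambda>\<omega>. innovation i (erased \<omega>) * innovation j (erased \<omega>))"
    unfolding eq by (rule Bochner_Integration.integrable_diff[OF *(2) integrable_mult_right[OF *(1)]])
  have "expectation (\<lambda>\<omega>. innovation i (erased \<omega>) * innovation j (erased \<omega>))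
      = expectation (\<lambda>\<omega>. of_bool (E (Suc i) \<omega>) * H (erased_upto i \<omega>))
        - expectation (\<lambda>\<omega>. \<epsilon> * H (erased_upto i \<omega>))"
    unfolding eq by (rule Bochner_Integration.integral_diff[OF *(2) integrable_mult_right[OF *(1)]])
  then show "expectation (\<lambda>\<omega>. innovation i (erased \<omega>) * innovation j (erased \<omega>)) = 0"
    using *(3) by (simp del: One_nat_def)
qed

text \<open>One step adds at most \<open>d\<close> to the lag and then multiplies the second moment
  by \<open>\<epsilon>\<close>, which is a contraction up to a constant.\<close>

lemma second_moments_bounded:
  "\<exists>K. \<forall>i. expectation (\<lambda>\<omega>. (lag i (erased \<omega>))\<^sup>2) \<le> K \<and>
    expectation (\<lambda>\<omega>. (candidate i (erased \<omega>))\<^sup>2) \<le> K"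
proof -
  define x where "x i = expectation (\<lambda>\<omega>. (lag i (erased \<omega>))\<^sup>2)" for i
  define y where "y i = expectation (\<lambda>\<omega>. (candidate i (erased \<omega>))\<^sup>2)" for i
  define c where "c = (1 + 1 / (1 - \<epsilon>)) * d\<^sup>2"
  \<comment> \<open>The weight \<open>1 - \<epsilon>\<close> in the weighted square makes the
    contraction factor \<open>1 - (1 - \<epsilon>)\<^sup>2\<close>.\<close>
  define \<rho> where "\<rho> = \<epsilon> * (1 + (1 - \<epsilon>))"
  have c: "0 \<le> c" using eps by (simp add: c_def)
  have "1 - \<rho> = (1 - \<epsilon>)\<^sup>2" by (simp add: \<rho>_def power2_eq_square algebra_simps)
  moreover have "(1 - \<epsilon>)\<^sup>2 > 0" using eps by simp
  ultimately have \<rho>: "0 \<le> \<rho>" "\<rho> < 1" using eps by (simp add: \<rho>_def, linarith)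
  have yx: "y i \<le> (1 + (1 - \<epsilon>)) * x i + c" for i
  proof -
    have pt: "(candidate i e)\<^sup>2 \<le> (1 + (1 - \<epsilon>)) * (lag i e)\<^sup>2 + c" for e
    proof -
      have "(candidate i e)\<^sup>2 \<le> (lag i e + d)\<^sup>2"
        using candidate_bounds[of i e] by (intro power_mono) auto
      also have "\<dots> \<le> (1 + (1 - \<epsilon>)) * (lag i e)\<^sup>2 + c"
        unfolding c_def using eps by (intro square_add_le_weighted) simp
      finally show ?thesis .
    qed
    have "y i \<le> expectation (\<lambda>\<omega>. (1 + (1 - \<epsilon>)) * (lag i (erased \<omega>))\<^sup>2 + c)"
      unfolding y_def
      by (intro integral_mono pt lag_sq_expectation_facts Bochner_Integration.integrable_add
          integrable_mult_right integrable_const)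
    also have "\<dots> = expectation (\<lambda>\<omega>. (1 + (1 - \<epsilon>)) * (lag i (erased \<omega>))\<^sup>2) + expectation (\<lambda>\<omega>. c)"
      by (intro Bochner_Integration.integral_add lag_sq_expectation_facts
          integrable_mult_right integrable_const)
    also have "\<dots> = (1 + (1 - \<epsilon>)) * x i + c"
      unfolding x_def Bochner_Integration.integral_mult_right_zero by (simp add: prob_space)
    finally show ?thesis .
  qed
  have step: "x (Suc i) \<le> \<rho> * x i + c" for i
  proof -
    have "x (Suc i) = \<epsilon> * y i" unfolding x_def y_def by (rule lag_sq_expectation_facts)
    also have "\<dots> \<le> \<epsilon> * ((1 + (1 - \<epsilon>)) * x i + c)" by (rule mult_left_mono[OF yx eps(1)])
    also have "\<dots> = \<rho> * x i + \<epsilon> * c" by (simp add: \<rho>_def algebra_simps)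
    also have "\<dots> \<le> \<rho> * x i + c" using eps c mult_right_mono[of \<epsilon> 1 c] by simp
    finally show ?thesis .
  qed
  have x0: "0 \<le> x i" for i unfolding x_def by simp
  define B where "B = x 0 + c / (1 - \<rho>)"
  have xB: "x i \<le> B" for i
    unfolding B_def by (rule affine_recursion_bound[of x, OF step \<rho> x0 c])
  have "y i \<le> (1 + (1 - \<epsilon>)) * B + c" for i
    using yx[of i] mult_left_mono[OF xB[of i], of "1 + (1 - \<epsilon>)"] eps by linarith
  moreover have "x i \<le> (1 + (1 - \<epsilon>)) * B + c" for i
  proof -
    have "0 \<le> B" using x0[of 0] xB[of 0] by linarith
    then have "0 \<le> (1 - \<epsilon>) * B" using eps by simp
    then show ?thesis using xB[of i] c unfolding distrib_right by linarith
  qed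
  ultimately show ?thesis unfolding x_def y_def by blast
qed

lemma AE_innovation_mean: "AE \<omega> in M. (\<lambda>n. (\<Sum>i<n. innovation i (erased \<omega>)) / real n) \<longlonglongrightarrow> 0"
proof -
  obtain K where K: "\<And>i. expectation (\<lambda>\<omega>. (candidate i (erased \<omega>))\<^sup>2) \<le> K"
    using second_moments_bounded by blast
  have le: "(innovation i e)\<^sup>2 \<le> (candidate i e)\<^sup>2" for i e
    using abs_innovation_le[of i e] by (metis abs_ge_zero power2_abs power_mono)
  have meas: "(\<lambda>\<omega>. innovation i (erased \<omega>)) \<in> borel_measurable M" for i
  proof -
    have "(\<lambda>\<omega>. erased_upto (Suc i) \<omega>) \<in> measurable M (Pi\<^sub>M {1..Suc i} (\<lambda>_. count_space UNIV))"
      using indep_E by (intro measurable_restrict) (auto simp: indep_vars_def)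
    from measurable_compose[OF this measurable_innovation[OF order_refl]]
    show ?thesis unfolding innovation_prefix[OF order_refl] .
  qed
  have sq: "integrable M (\<lambda>\<omega>. (innovation i (erased \<omega>))\<^sup>2)" for i
    by (rule Bochner_Integration.integrable_bound[OF lag_sq_expectation_facts(2)[of i]])
      (use le meas[of i] in auto)
  show ?thesis
  proof (rule strong_law_orthogonal)
    fix i j :: nat
    show "integrable M (\<lambda>\<omega>. innovation i (erased \<omega>) * innovation j (erased \<omega>))"
    proof (cases i j rule: linorder_cases)
      case less
      then show ?thesis using expectation_innovation_mult(1)[OF less] by (simp add: mult.commute)
    next
      case equal
      then show ?thesis using sq[of j] by (simp add: power2_eq_square)
    next
      case greater
      then show ?thesis by (rule expectation_innovation_mult(1))
    qed
    show "expectation (\<lambda>\<omega>. innovation i (erased \<omega>) * innovation j (erased \<omega>)) = 0" if "i \<noteq> j"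
    proof (cases "i < j")
      case True
      then show ?thesis using expectation_innovation_mult(2)[OF True] by (simp add: mult.commute)
    next
      case False
      then show ?thesis using that by (intro expectation_innovation_mult(2)) simp
    qed
    have "expectation (\<lambda>\<omega>. (innovation i (erased \<omega>))\<^sup>2) \<le> expectation (\<lambda>\<omega>. (candidate i (erased \<omega>))\<^sup>2)"
      by (intro integral_mono sq lag_sq_expectation_facts le)
    then show "expectation (\<lambda>\<omega>. (innovation i (erased \<omega>))\<^sup>2) \<le> K" using K[of i] by linarith
  qed
qed

text \<open>Bounded second moments divided by \<open>n\<^sup>2\<close> are summable. This disposes
  of the boundary term in the summed recursion for the lag.\<close>

lemma AE_lag_sublinear: "AE \<omega> in M. (\<lambda>n. lag n (erased \<omega>) / real n) \<longlonglongrightarrow> 0"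
proof -
  obtain K where K: "\<And>i. expectation (\<lambda>\<omega>. (lag i (erased \<omega>))\<^sup>2) \<le> K"
    using second_moments_bounded by blast
  have "AE \<omega> in M. (\<lambda>n. (lag n (erased \<omega>))\<^sup>2 / (real n)\<^sup>2) \<longlonglongrightarrow> 0"
  proof (rule AE_tendsto_zero_if_summable_expectation)
    show "integrable M (\<lambda>\<omega>. (lag n (erased \<omega>))\<^sup>2 / (real n)\<^sup>2)" for n
      by (rule integrable_divide[OF lag_sq_expectation_facts(1)])
    show "expectation (\<lambda>\<omega>. (lag n (erased \<omega>))\<^sup>2 / (real n)\<^sup>2) \<le> K * inverse (real n ^ 2)" for n
    proof -
      have "expectation (\<lambda>\<omega>. (lag n (erased \<omega>))\<^sup>2 / (real n)\<^sup>2)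
          = expectation (\<lambda>\<omega>. (lag n (erased \<omega>))\<^sup>2) / (real n)\<^sup>2" by simp
      also have "\<dots> \<le> K / (real n)\<^sup>2" by (intro divide_right_mono K) simp
      finally show ?thesis by (simp add: divide_inverse)
    qed
    show "summable (\<lambda>n. K * inverse (real n ^ 2))"
      by (intro summable_mult inverse_power_summable) simp
  qed simp
  then show ?thesis
  proof eventually_elim
    case (elim \<omega>)
    then have "(\<lambda>n. sqrt ((lag n (erased \<omega>) / real n)\<^sup>2)) \<longlonglongrightarrow> sqrt 0"
      unfolding power_divide by (rule tendsto_real_sqrt)
    then show ?case unfolding real_sqrt_abs real_sqrt_zero by (rule tendsto_rabs_zero_cancel)
  qed
qed

text \<open>Sums the recursion that expresses the next lag as innovation plus
  \<open>\<epsilon>\<close> times the candidate; the increments of \<open>G\<close> and of the lag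
  telescope.\<close>

lemma sum_lag_eq:
  "(1 - \<epsilon>) * (\<Sum>i<n. lag i e)
    = (\<Sum>i<n. innovation i e) + \<epsilon> * (real (G n) - real (G 0)) - lag n e + lag 0 e"
proof (induction n)
  case (Suc n)
  have "lag (Suc n) e = innovation n e + \<epsilon> * (lag n e + (real (G (Suc n)) - real (G n)))"
    unfolding lag_Suc innovation_def by (simp add: candidate_def lag_def algebra_simps)
  then show ?case using Suc.IH by (simp add: algebra_simps)
qed simp

text \<open>In the summed recursion divided by \<open>n\<close> only the growth of \<open>G\<close>
  survives. The factor \<open>\<epsilon> / (1 - \<epsilon>)\<close> is the long-run mean number of
  uses since the last unerased one.\<close>

theorem AE_lag_mean:
  assumes G: "(\<lambda>n. real (G n) / real n) \<longlonglongrightarrow> \<alpha>"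
  shows "AE \<omega> in M. (\<lambda>n. (\<Sum>i<n. lag i (erased \<omega>)) / real n) \<longlonglongrightarrow> \<epsilon> * \<alpha> / (1 - \<epsilon>)"
  using AE_innovation_mean AE_lag_sublinear
proof eventually_elim
  case (elim \<omega>)
  let ?r = "\<lambda>n. (\<Sum>i<n. innovation i (erased \<omega>)) / real n + \<epsilon> * (real (G n) / real n)
    - lag n (erased \<omega>) / real n + (lag 0 (erased \<omega>) - \<epsilon> * real (G 0)) / real n"
  have "(\<lambda>n. ?r n / (1 - \<epsilon>)) \<longlonglongrightarrow> (0 + \<epsilon> * \<alpha> - 0 + 0) / (1 - \<epsilon>)"
    using eps by (intro tendsto_intros elim G lim_const_over_n) simp
  moreover have "?r n / (1 - \<epsilon>) = (\<Sum>i<n. lag i (erased \<omega>)) / real n" for n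
  proof -
    have "?r n = ((1 - \<epsilon>) * (\<Sum>i<n. lag i (erased \<omega>))) / real n"
      unfolding sum_lag_eq by (simp add: add_divide_distrib diff_divide_distrib right_diff_distrib)
    then show ?thesis using eps by simp
  qed
  ultimately show ?case by simp
qed

end

section \<open>Time averages of staircase ages\<close>

lemma eventually_zero_mean_tendsto_zero:
  fixes z :: "nat \<Rightarrow> real"
  assumes "\<And>i. i \<ge> N \<Longrightarrow> z i = 0"
  shows "(\<lambda>n. (\<Sum>i<n. z i) / real n) \<longlonglongrightarrow> 0"
proof (rule bounded_div_tendsto_zero)
  fix n
  have N: "i < N" if "z i \<noteq> 0" for i using assms that by (meson not_le)
  have "\<bar>\<Sum>i<n. z i\<bar> \<le> (\<Sum>i<n. \<bar>z i\<bar>)" by (rule sum_abs)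
  also have "\<dots> = (\<Sum>i\<in>{..<n} \<inter> {..<N}. \<bar>z i\<bar>)"
    by (intro sum.mono_neutral_right) (auto dest: N)
  also have "\<dots> \<le> (\<Sum>i<N. \<bar>z i\<bar>)" by (intro sum_mono2) auto
  finally show "\<bar>\<Sum>i<n. z i\<bar> \<le> (\<Sum>i<N. \<bar>z i\<bar>)" .
qed

text \<open>Up to the factor \<open>(n + 1) / n\<close>, the quotient is a difference of consecutive
  means.\<close>

lemma mean_convergent_imp_sublinear:
  fixes b :: "nat \<Rightarrow> real"
  assumes "(\<lambda>n. (\<Sum>i<n. b i) / real n) \<longlonglongrightarrow> L"
  shows "(\<lambda>n. b n / real n) \<longlonglongrightarrow> 0"
proof -
  let ?S = "\<lambda>n. (\<Sum>i<n. b i)"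
  have "(\<lambda>n. ?S (Suc n) / real (Suc n) * (1 + 1 / real n) - ?S n / real n) \<longlonglongrightarrow> L * (1 + 0) - L"
    by (intro tendsto_intros LIMSEQ_Suc[OF assms] assms lim_const_over_n)
  moreover have "\<forall>\<^sub>F n in sequentially.
      ?S (Suc n) / real (Suc n) * (1 + 1 / real n) - ?S n / real n = b n / real n"
    using eventually_gt_at_top[of 0]
  proof eventually_elim
    case (elim n)
    have "1 + 1 / real n = real (Suc n) / real n" using elim by (simp add: field_simps)
    then have "?S (Suc n) / real (Suc n) * (1 + 1 / real n) = ?S (Suc n) / real n" by simp
    then show ?case by (simp add: add_divide_distrib)
  qed
  ultimately show ?thesis by (auto dest: Lim_transform_eventually)
qed

lemma has_integral_staircase_piece:
  fixes T \<tau> :: real and a :: "nat \<Rightarrow> real"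
  assumes T: "T > 0" and \<tau>: "real n * T \<le> \<tau>" "\<tau> \<le> real (Suc n) * T"
  shows "((\<lambda>t. t + a (nat \<lfloor>t / T\<rfloor>)) has_integral
    ((\<tau>\<^sup>2 - (real n * T)\<^sup>2) / 2 + (\<tau> - real n * T) * a n)) {real n * T..\<tau>}"
\<comment> \<open>At the right endpoint \<open>real (Suc n) * T\<close> the floor has already
  jumped; this single point does not affect the integral.\<close>
proof (rule has_integral_spike_finite)
  have "((\<lambda>t. a n) has_integral (\<tau> - real n * T) * a n) {real n * T..\<tau>}"
    using has_integral_const_real[of "a n" "real n * T" \<tau>] \<tau> by simp
  then show "((\<lambda>t. t + a n) has_integral
      ((\<tau>\<^sup>2 - (real n * T)\<^sup>2) / 2 + (\<tau> - real n * T) * a n)) {real n * T..\<tau>}"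
    by (intro has_integral_add ident_has_integral \<tau>)
  fix t assume t: "t \<in> {real n * T..\<tau>} - {real (Suc n) * T}"
  then have "real n * T \<le> t" "t < real (Suc n) * T" using \<tau> by auto
  then have "real n \<le> t / T" "t / T < real n + 1" using T by (simp_all add: field_simps)
  then have "\<lfloor>t / T\<rfloor> = int n" by linarith
  then show "t + a (nat \<lfloor>t / T\<rfloor>) = t + a n" by simp
qed simp

lemma has_integral_staircase:
  fixes T \<tau> :: real and a :: "nat \<Rightarrow> real"
  assumes T: "T > 0" and \<tau>: "real n * T \<le> \<tau>" "\<tau> \<le> real (Suc n) * T"
  shows "((\<lambda>t. t + a (nat \<lfloor>t / T\<rfloor>)) has_integral
    (\<tau>\<^sup>2 / 2 + T * (\<Sum>i<n. a i) + (\<tau> - real n * T) * a n)) {0..\<tau>}"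
proof -
  let ?f = "\<lambda>t. t + a (nat \<lfloor>t / T\<rfloor>)"
  have base: "(?f has_integral ((real n * T)\<^sup>2 / 2 + T * (\<Sum>i<n. a i))) {0..real n * T}" for n
  proof (induction n)
    case (Suc n)
    have "(?f has_integral ((real n * T)\<^sup>2 / 2 + T * (\<Sum>i<n. a i)) +
        (((real (Suc n) * T)\<^sup>2 - (real n * T)\<^sup>2) / 2 + (real (Suc n) * T - real n * T) * a n)) {0..real (Suc n) * T}"
      by (rule has_integral_combine[OF _ _ Suc.IH has_integral_staircase_piece])
        (use T in \<open>auto simp: mult_right_mono\<close>)
    then show ?case by (simp add: algebra_simps diff_divide_distrib)
  qed (simp add: has_integral_refl)
  have "(?f has_integral ((real n * T)\<^sup>2 / 2 + T * (\<Sum>i<n. a i)) +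
      ((\<tau>\<^sup>2 - (real n * T)\<^sup>2) / 2 + (\<tau> - real n * T) * a n)) {0..\<tau>}"
    by (rule has_integral_combine[OF _ _ base has_integral_staircase_piece]) (use T \<tau> in auto)
  then show ?thesis by (simp add: algebra_simps diff_divide_distrib)
qed

lemma staircase_index:
  fixes T \<tau> :: real
  assumes "T > 0" "\<tau> \<ge> 0"
  shows "real (nat \<lfloor>\<tau> / T\<rfloor>) * T \<le> \<tau>" "\<tau> \<le> real (Suc (nat \<lfloor>\<tau> / T\<rfloor>)) * T"
proof -
  have "0 \<le> \<tau> / T" using assms by simp
  then have "real (nat \<lfloor>\<tau> / T\<rfloor>) \<le> \<tau> / T" "\<tau> / T \<le> real (Suc (nat \<lfloor>\<tau> / T\<rfloor>))" by linarith+
  then show "real (nat \<lfloor>\<tau> / T\<rfloor>) * T \<le> \<tau>" "\<tau> \<le> real (Suc (nat \<lfloor>\<tau> / T\<rfloor>)) * T"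
    using assms(1) by (simp_all only: pos_le_divide_eq pos_divide_le_eq)
qed

text \<open>Between two uses the function rises with slope 1 from its value at the earlier use,
  which adds \<open>T / 2\<close> on average. The incomplete last interval is negligible because the
  values at the uses are sublinear.\<close>

lemma staircase_mean_tendsto:
  fixes T :: real and a :: "nat \<Rightarrow> real"
  assumes T: "T > 0" and L: "(\<lambda>n. (\<Sum>i<n. real i * T + a i) / real n) \<longlonglongrightarrow> L"
  shows "((\<lambda>\<tau>. 1 / \<tau> * integral {0..\<tau>} (\<lambda>t. t + a (nat \<lfloor>t / T\<rfloor>))) \<longlongrightarrow> L + T / 2) at_top"
proof -
  define b where "b i = real i * T + a i" for i
  define N where "N \<tau> = nat \<lfloor>\<tau> / T\<rfloor>" for \<tau>
  define r where "r \<tau> = \<tau> - real (N \<tau>) * T" for \<tau>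
  have bL: "(\<lambda>n. (\<Sum>i<n. b i) / real n) \<longlonglongrightarrow> L" using L by (simp add: b_def)
  have b0: "(\<lambda>n. b n / real n) \<longlonglongrightarrow> 0" by (rule mean_convergent_imp_sublinear[OF bL])
  have r: "0 \<le> r \<tau>" "r \<tau> \<le> T" if "\<tau> \<ge> 0" for \<tau>
    using staircase_index[OF T that] by (simp_all add: r_def N_def algebra_simps)
  have Ntop: "filterlim N at_top at_top"
    unfolding filterlim_at_top
  proof
    fix Z :: nat
    show "\<forall>\<^sub>F \<tau> in at_top. Z \<le> N \<tau>"
      using eventually_ge_at_top[of "real Z * T"]
    proof eventually_elim
      case (elim \<tau>)
      then have "real Z \<le> \<tau> / T" using T by (simp add: pos_le_divide_eq)
      then show ?case unfolding N_def by linarith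
    qed
  qed
  \<comment> \<open>With \<open>n = N \<tau>\<close> complete intervals, the integral is
    \<open>n * T * ?v \<tau>\<close> and \<open>n * T = \<tau> * ?u \<tau>\<close>;
    \<open>r \<tau>\<close> is the time since the last use.\<close>
  let ?u = "\<lambda>\<tau>. 1 - r \<tau> / \<tau>"
  let ?v = "\<lambda>\<tau>. T / 2 + (\<Sum>i<N \<tau>. b i) / real (N \<tau>) + r \<tau> / T * (b (N \<tau>) / real (N \<tau>)) + (r \<tau>)\<^sup>2 / (2 * T) / real (N \<tau>)"
  have sum_id: "(\<Sum>i<n. a i) = (\<Sum>i<n. b i) - T * (real n * (real n - 1) / 2)" for n
    by (induction n) (simp_all add: b_def field_simps)
  have eq: "1 / \<tau> * integral {0..\<tau>} (\<lambda>t. t + a (nat \<lfloor>t / T\<rfloor>)) = ?u \<tau> * ?v \<tau>" if \<tau>: "\<tau> \<ge> T" for \<tau>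
  proof -
    have "\<tau> > 0" using \<tau> T by simp
    have "1 \<le> \<tau> / T" using \<tau> T by simp
    then have N1: "N \<tau> \<ge> 1" unfolding N_def by linarith
    define n where "n = real (N \<tau>)"
    have n: "n > 0" using N1 by (simp add: n_def)
    have \<tau>n: "\<tau> = n * T + r \<tau>" by (simp add: r_def n_def)
    have "integral {0..\<tau>} (\<lambda>t. t + a (nat \<lfloor>t / T\<rfloor>))
        = \<tau>\<^sup>2 / 2 + T * (\<Sum>i<N \<tau>. a i) + (\<tau> - real (N \<tau>) * T) * a (N \<tau>)"
      using staircase_index[OF T, of \<tau>] \<open>\<tau> > 0\<close> unfolding N_def
      by (intro integral_unique has_integral_staircase T) auto
    also have "\<dots> = (n * T + r \<tau>)\<^sup>2 / 2 + T * ((\<Sum>i<N \<tau>. b i) - T * (n * (n - 1) / 2)) + r \<tau> * (b (N \<tau>) - n * T)"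
      unfolding sum_id \<tau>n[symmetric] by (simp add: b_def n_def r_def)
    also have "\<dots> = n * T\<^sup>2 / 2 + T * (\<Sum>i<N \<tau>. b i) + r \<tau> * b (N \<tau>) + (r \<tau>)\<^sup>2 / 2"
      by (simp add: power2_eq_square algebra_simps add_divide_distrib diff_divide_distrib)
    also have "\<dots> = n * T * ?v \<tau>"
      unfolding n_def[symmetric] using n T by (simp add: field_simps power2_eq_square)
    also have "n * T = \<tau> - r \<tau>" by (simp add: r_def n_def)
    also have "\<dots> = \<tau> * ?u \<tau>" using \<open>\<tau> > 0\<close> by (simp add: right_diff_distrib)
    finally show ?thesis using \<open>\<tau> > 0\<close> by simp
  qed
  have T0: "((\<lambda>\<tau>. T / \<tau>) \<longlongrightarrow> 0) at_top"
    by (rule real_tendsto_divide_at_top[OF tendsto_const filterlim_ident])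
  have u: "(?u \<longlongrightarrow> 1 - 0) at_top"
  proof (intro tendsto_diff tendsto_const Lim_null_comparison[OF _ T0])
    show "\<forall>\<^sub>F \<tau> in at_top. norm (r \<tau> / \<tau>) \<le> T / \<tau>"
      using eventually_gt_at_top[of 0]
      by eventually_elim (use r in \<open>simp add: divide_right_mono abs_of_nonneg\<close>)
  qed
  have v3: "((\<lambda>\<tau>. r \<tau> / T * (b (N \<tau>) / real (N \<tau>))) \<longlongrightarrow> 0) at_top"
  proof (rule Lim_null_comparison)
    show "((\<lambda>\<tau>. \<bar>b (N \<tau>) / real (N \<tau>)\<bar>) \<longlongrightarrow> 0) at_top"
      by (rule tendsto_rabs_zero[OF filterlim_compose[OF b0 Ntop]])
    show "\<forall>\<^sub>F \<tau> in at_top. norm (r \<tau> / T * (b (N \<tau>) / real (N \<tau>))) \<le> \<bar>b (N \<tau>) / real (N \<tau>)\<bar>"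
      using eventually_gt_at_top[of 0]
    proof eventually_elim
      case (elim \<tau>)
      then have "\<bar>r \<tau> / T\<bar> \<le> 1" using r[of \<tau>] T by simp
      then show ?case
        unfolding real_norm_def abs_mult[of "r \<tau> / T"] by (rule mult_left_le_one_le[rotated 2]) auto
    qed
  qed
  have v4: "((\<lambda>\<tau>. (r \<tau>)\<^sup>2 / (2 * T) / real (N \<tau>)) \<longlongrightarrow> 0) at_top"
  proof (rule Lim_null_comparison)
    show "((\<lambda>\<tau>. T\<^sup>2 / (2 * T) / real (N \<tau>)) \<longlongrightarrow> 0) at_top"
      by (rule filterlim_compose[OF lim_const_over_n Ntop])
    show "\<forall>\<^sub>F \<tau> in at_top. norm ((r \<tau>)\<^sup>2 / (2 * T) / real (N \<tau>)) \<le> T\<^sup>2 / (2 * T) / real (N \<tau>)"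
      using eventually_gt_at_top[of 0]
    proof eventually_elim
      case (elim \<tau>)
      have "(r \<tau>)\<^sup>2 / (2 * T) / real (N \<tau>) \<le> T\<^sup>2 / (2 * T) / real (N \<tau>)"
        using r[of \<tau>] elim T by (intro divide_right_mono power_mono) auto
      then show ?case using T by simp
    qed
  qed
  have "((\<lambda>\<tau>. ?u \<tau> * ?v \<tau>) \<longlongrightarrow> (1 - 0) * (T / 2 + L + 0 + 0)) at_top"
    by (intro tendsto_mult u tendsto_add tendsto_const filterlim_compose[OF bL Ntop] v3 v4)
  moreover have "\<forall>\<^sub>F \<tau> in at_top. ?u \<tau> * ?v \<tau> = 1 / \<tau> * integral {0..\<tau>} (\<lambda>t. t + a (nat \<lfloor>t / T\<rfloor>))"
    using eventually_ge_at_top[of T] by eventually_elim (rule eq[symmetric])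
  ultimately have "((\<lambda>\<tau>. 1 / \<tau> * integral {0..\<tau>} (\<lambda>t. t + a (nat \<lfloor>t / T\<rfloor>)))
      \<longlongrightarrow> (1 - 0) * (T / 2 + L + 0 + 0)) at_top"
    by (rule Lim_transform_eventually)
  then show ?thesis by (simp add: add.commute)
qed

section \<open>Existence and comparison of average ages\<close>

context timing
begin

text \<open>The floor costs at most 1, and replacing negative values by 0 costs at most
  \<open>\<bar>t0 / Ts\<bar>\<close>.\<close>

lemma num_generated_approx:
  "\<bar>real (G i) - (real i * (Tc / Ts) - t0 / Ts)\<bar> \<le> 1 + \<bar>t0 / Ts\<bar>"
proof -
  define x where "x = (real i * Tc - t0) / Ts"
  have x: "x = real i * (Tc / Ts) - t0 / Ts" by (simp add: x_def diff_divide_distrib)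
  have "0 \<le> real i * (Tc / Ts)" using Tc_pos Ts_pos by simp
  then have "\<bar>real (nat \<lfloor>x\<rfloor>) - x\<bar> \<le> 1 + \<bar>t0 / Ts\<bar>"
    using x by (cases "x \<ge> 0") linarith+
  then show ?thesis by (simp add: num_generated_def x flip: x_def)
qed

lemma num_generated_increment: "real (G (Suc i)) - real (G i) \<le> Tc / Ts + 2 * (1 + \<bar>t0 / Ts\<bar>)"
proof -
  define \<alpha> \<beta> where "\<alpha> = Tc / Ts" and "\<beta> = t0 / Ts"
  have "\<bar>real (G j) - (real j * \<alpha> - \<beta>)\<bar> \<le> 1 + \<bar>\<beta>\<bar>" for j
    unfolding \<alpha>_def \<beta>_def by (rule num_generated_approx)
  from abs_le_D2[OF this[of i]] abs_le_D1[OF this[of "Suc i"]] show ?thesis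
    unfolding \<alpha>_def[symmetric] \<beta>_def[symmetric] by (simp add: algebra_simps)
qed

lemma num_generated_rate: "(\<lambda>n. real (G n) / real n) \<longlonglongrightarrow> Tc / Ts"
proof -
  define B where "B = 1 + 2 * \<bar>t0 / Ts\<bar>"
  have "(\<lambda>n. (real (G n) - real n * (Tc / Ts)) / real n) \<longlonglongrightarrow> 0"
  proof (rule bounded_div_tendsto_zero)
    show "\<bar>real (G n) - real n * (Tc / Ts)\<bar> \<le> B" for n
      using num_generated_approx[of n] abs_triangle_ineq[of "real (G n) - (real n * (Tc / Ts) - t0 / Ts)" "- (t0 / Ts)"]
      by (simp add: B_def)
  qed
  then have "(\<lambda>n. (real (G n) - real n * (Tc / Ts)) / real n + Tc / Ts) \<longlonglongrightarrow> 0 + Tc / Ts"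
    by (intro tendsto_intros)
  moreover have "\<forall>\<^sub>F n in sequentially.
      (real (G n) - real n * (Tc / Ts)) / real n + Tc / Ts = real (G n) / real n"
    using eventually_gt_at_top[of 0] by eventually_elim (simp add: diff_divide_distrib)
  ultimately show ?thesis by (auto dest: Lim_transform_eventually)
qed

text \<open>At a use, the age of the newest generated symbol is \<open>Ts\<close> times a fractional
  part, except at finitely many early uses where the count is truncated at 0; \<open>z\<close> is
  the correction there.\<close>

lemma delay_mean_convergent:
  "\<exists>L. (\<lambda>n. (\<Sum>i<n. real i * Tc - t0 - real (G i) * Ts) / real n) \<longlonglongrightarrow> L"
proof -
  define x where "x i = real i * (Tc / Ts) + (- t0 / Ts)" for i
  define z where "z i = real_of_int \<lfloor>x i\<rfloor> - real (G i)" for i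
  obtain L where L: "(\<lambda>n. (\<Sum>i<n. frac (x i)) / real n) \<longlonglongrightarrow> L"
    using frac_progression_mean_convergent unfolding x_def by blast
  have xG: "G i = nat \<lfloor>x i\<rfloor>" for i by (simp add: num_generated_def x_def diff_divide_distrib)
  have z0: "z i = 0" if "i \<ge> nat \<lceil>t0 / Tc\<rceil>" for i
  proof -
    have "t0 / Tc \<le> real i" using that by linarith
    then have "t0 \<le> real i * Tc" using Tc_pos by (simp add: pos_divide_le_eq)
    then have "0 \<le> (real i * Tc - t0) / Ts" using Ts_pos by simp
    then have "0 \<le> x i" by (simp add: x_def diff_divide_distrib)
    then show ?thesis by (simp add: z_def xG)
  qed
  have "(\<lambda>n. Ts * ((\<Sum>i<n. frac (x i)) / real n) + Ts * ((\<Sum>i<n. z i) / real n)) \<longlonglongrightarrow> Ts * L + Ts * 0"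
    by (intro tendsto_intros L eventually_zero_mean_tendsto_zero[OF z0])
  moreover have "real i * Tc - t0 - real (G i) * Ts = Ts * frac (x i) + Ts * z i" for i
  proof -
    have "Ts * x i = real i * Tc - t0" using Ts_pos by (simp add: x_def field_simps)
    then show ?thesis by (simp add: frac_def z_def algebra_simps)
  qed
  ultimately show ?thesis
    by (intro exI[of _ "Ts * L + Ts * 0"])
      (simp add: sum.distrib add_divide_distrib flip: sum_distrib_left)
qed

lemma inst_age_staircase:
  "inst_age Tc Ts t0 U E C \<omega>
    = (\<lambda>t. t + (- real (decoded_index Tc Ts t0 U E C (nat \<lfloor>t / Tc\<rfloor>) \<omega>) * Ts - t0))"
  by (simp add: inst_age_def fun_eq_iff)

lemma integrable_inst_age:
  assumes "\<tau> \<ge> 0"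
  shows "inst_age Tc Ts t0 U E C \<omega> integrable_on {0..\<tau>}"
  unfolding inst_age_staircase
  by (rule has_integral_integrable[OF has_integral_staircase[where n = "nat \<lfloor>\<tau> / Tc\<rfloor>"]])
    (intro Tc_pos staircase_index assms)+

text \<open>On almost every sample path the ages are ordered at all times, hence so are the
  integrals and their limits. The limits are constants, so one such path suffices.\<close>

lemma average_age_antimono:
  assumes "prob_space M"
    and le: "AE \<omega> in M. \<forall>i. decoded_index Tc Ts t0 U E C i \<omega> \<le> decoded_index Tc Ts t0 U E C' i \<omega>"
    and D: "has_average_age M Tc Ts t0 U E C D" and D': "has_average_age M Tc Ts t0 U E C' D'"
  shows "D' \<le> D"
proof -
  interpret prob_space M by fact
  have "AE \<omega> in M. D' \<le> D"
    using le D[unfolded has_average_age_def] D'[unfolded has_average_age_def]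
  proof eventually_elim
    case (elim \<omega>)
    have "\<forall>\<^sub>F \<tau> in at_top. ereal (1 / \<tau> * integral {0..\<tau>} (inst_age Tc Ts t0 U E C' \<omega>))
        \<le> ereal (1 / \<tau> * integral {0..\<tau>} (inst_age Tc Ts t0 U E C \<omega>))"
      using eventually_ge_at_top[of 0]
    proof eventually_elim
      case (elim \<tau>)
      have "integral {0..\<tau>} (inst_age Tc Ts t0 U E C' \<omega>) \<le> integral {0..\<tau>} (inst_age Tc Ts t0 U E C \<omega>)"
        using \<open>\<forall>i. decoded_index Tc Ts t0 U E C i \<omega> \<le> decoded_index Tc Ts t0 U E C' i \<omega>\<close> Ts_pos
        by (intro integral_le integrable_inst_age elim) (simp add: inst_age_def)
      then have "1 / \<tau> * integral {0..\<tau>} (inst_age Tc Ts t0 U E C' \<omega>)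
          \<le> 1 / \<tau> * integral {0..\<tau>} (inst_age Tc Ts t0 U E C \<omega>)"
        using elim by (intro mult_left_mono) auto
      then show ?case by simp
    qed
    from tendsto_le[OF _ elim(2,3) this] show ?case by simp
  qed
  then show ?thesis by simp
qed

text \<open>The age at a use is the delay of the newest generated symbol plus \<open>Ts\<close>
  times the lag, and both have convergent means if \<open>\<epsilon> < 1\<close>. If
  \<open>\<epsilon> = 1\<close>, almost surely nothing is ever delivered and the age is
  \<open>t - t0\<close>.\<close>

lemma freshest_average_age_exists:
  assumes "prob_space M" and E: "memoryless_erasures M E \<epsilon>" and eps: "0 \<le> \<epsilon>" "\<epsilon> \<le> 1"
    and dec: "\<And>i \<omega>. decoded_index Tc Ts t0 U E C i \<omega> = freshest G (\<lambda>j. E j \<omega>) i"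
  shows "\<exists>D. has_average_age M Tc Ts t0 U E C D"
proof -
  interpret prob_space M by fact
  have ind: "indep_vars (\<lambda>_. count_space UNIV) E {1..}"
    and prob: "\<And>j. j \<ge> 1 \<Longrightarrow> prob {\<omega> \<in> space M. E j \<omega>} = \<epsilon>"
    using E by (auto simp: memoryless_erasures_def)
  have age: "inst_age Tc Ts t0 U E C \<omega>
      = (\<lambda>t. t + (- real (freshest G (\<lambda>j. E j \<omega>) (nat \<lfloor>t / Tc\<rfloor>)) * Ts - t0))" for \<omega>
    unfolding inst_age_staircase dec ..
  show ?thesis
  proof (cases "\<epsilon> < 1")
    case True
    interpret erasure_lag M E \<epsilon> G "Tc / Ts + 2 * (1 + \<bar>t0 / Ts\<bar>)"
      by unfold_locales (use ind prob True eps mono_num_generated num_generated_increment in auto)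
    obtain L where L: "(\<lambda>n. (\<Sum>i<n. real i * Tc - t0 - real (G i) * Ts) / real n) \<longlonglongrightarrow> L"
      using delay_mean_convergent by blast
    \<comment> \<open>Mean delay, mean lag in units of time, and the mean growth of the age between
      two uses.\<close>
    define D where "D = L + Ts * (\<epsilon> * (Tc / Ts) / (1 - \<epsilon>)) + Tc / 2"
    have "AE \<omega> in M. ((\<lambda>\<tau>. ereal (1 / \<tau> * integral {0..\<tau>} (inst_age Tc Ts t0 U E C \<omega>)))
        \<longlongrightarrow> ereal D) at_top"
      using AE_lag_mean[OF num_generated_rate]
    proof eventually_elim
      case (elim \<omega>)
      let ?a = "\<lambda>i. - real (freshest G (\<lambda>j. E j \<omega>) i) * Ts - t0"
      have "real i * Tc + ?a i = (real i * Tc - t0 - real (G i) * Ts) + Ts * lag i (\<lambda>j. E j \<omega>)" for i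
        by (simp add: lag_def algebra_simps)
      then have "(\<Sum>i<n. real i * Tc + ?a i) / real n
          = (\<Sum>i<n. real i * Tc - t0 - real (G i) * Ts) / real n
            + Ts * ((\<Sum>i<n. lag i (\<lambda>j. E j \<omega>)) / real n)" for n
        by (simp only: sum.distrib add_divide_distrib sum_distrib_left[symmetric] times_divide_eq_right)
      moreover have "(\<lambda>n. (\<Sum>i<n. real i * Tc - t0 - real (G i) * Ts) / real n
            + Ts * ((\<Sum>i<n. lag i (\<lambda>j. E j \<omega>)) / real n))
          \<longlonglongrightarrow> L + Ts * (\<epsilon> * (Tc / Ts) / (1 - \<epsilon>))"
        by (intro tendsto_add tendsto_mult tendsto_const L elim)
      ultimately have "(\<lambda>n. (\<Sum>i<n. real i * Tc + ?a i) / real n)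
          \<longlonglongrightarrow> L + Ts * (\<epsilon> * (Tc / Ts) / (1 - \<epsilon>))" by simp
      from staircase_mean_tendsto[OF Tc_pos this] show ?case
        unfolding age D_def by (intro tendsto_ereal)
    qed
    then show ?thesis unfolding has_average_age_def by blast
  next
    case False
    then have "\<epsilon> = 1" using eps by simp
    have "AE \<omega> in M. E j \<omega>" if "j \<ge> 1" for j
      using AE_prob_1[of "{\<omega> \<in> space M. E j \<omega>}"] prob[OF that] \<open>\<epsilon> = 1\<close> by simp
    then have "AE \<omega> in M. \<forall>j\<in>{1..}. E j \<omega>" by (subst AE_ball_countable) auto
    then have "AE \<omega> in M. ((\<lambda>\<tau>. ereal (1 / \<tau> * integral {0..\<tau>} (inst_age Tc Ts t0 U E C \<omega>)))
        \<longlongrightarrow> \<infinity>) at_top"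
    proof eventually_elim
      case (elim \<omega>)
      have "freshest G (\<lambda>j. E j \<omega>) i = 0" for i
        using freshest_cong[of i "\<lambda>j. E j \<omega>" "\<lambda>j. True" G] elim by (induction i) auto
      then have age': "inst_age Tc Ts t0 U E C \<omega> = (\<lambda>t. t + - t0)" unfolding age by simp
      have "1 / \<tau> * integral {0..\<tau>} (inst_age Tc Ts t0 U E C \<omega>) = \<tau> / 2 - t0" if "\<tau> > 0" for \<tau>
      proof -
        have "((\<lambda>t. t + - t0) has_integral (\<tau>\<^sup>2 - 0\<^sup>2) / 2 + (\<tau> - 0) *\<^sub>R (- t0)) {0..\<tau>}"
          using that has_integral_const_real[of "- t0" 0 \<tau>]
          by (intro has_integral_add ident_has_integral) auto
        then have "integral {0..\<tau>} (inst_age Tc Ts t0 U E C \<omega>) = \<tau>\<^sup>2 / 2 - \<tau> * t0"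
          unfolding age' by (simp add: integral_unique)
        then show ?thesis using that by (simp add: power2_eq_square field_simps)
      qed
      then have eq: "\<forall>\<^sub>F \<tau> in at_top. ereal (\<tau> / 2 - t0)
          = ereal (1 / \<tau> * integral {0..\<tau>} (inst_age Tc Ts t0 U E C \<omega>))"
        by (intro eventually_mono[OF eventually_gt_at_top[of 0]]) simp
      have "filterlim (\<lambda>\<tau>. - t0 + \<tau> * (1 / 2)) at_top at_top"
        by (intro filterlim_tendsto_add_at_top[OF tendsto_const]
            filterlim_at_top_mult_tendsto_pos[OF tendsto_const] filterlim_ident) simp
      then have "((\<lambda>\<tau>. ereal (\<tau> / 2 - t0)) \<longlongrightarrow> \<infinity>) at_top"
        by (simp add: tendsto_PInfty_eq_at_top)
      then show ?case using eq by (rule Lim_transform_eventually)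
    qed
    then show ?thesis unfolding has_average_age_def by blast
  qed
qed

end

text \<open>Both sides are compared with \<open>freshest\<close>: the policy attains it at every
  sample point, and a valid scheme almost surely never exceeds it.\<close>

theorem theorem1:
  fixes M :: "'w measure" and U :: "nat \<Rightarrow> 'w \<Rightarrow> 'a::finite" and E :: "nat \<Rightarrow> 'w \<Rightarrow> bool"
    and \<epsilon> Tc Ts t0 :: real and q :: nat
    and f :: "nat \<Rightarrow> 'a list \<Rightarrow> 'a" and Copt :: "('a, 'a) coding_scheme"
  assumes "CARD('a) = q" and "q \<ge> 2"
    and "0 \<le> \<epsilon>" and "\<epsilon> \<le> 1" and "Tc > 0" and "Ts > 0"
    and "prob_space M"
    and "memoryless_source M U"
    and "memoryless_erasures M E \<epsilon>"
    and "source_indep_erasures M U E"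
    and "\<And>i w. i \<ge> 1 \<Longrightarrow> num_generated Tc Ts t0 i \<ge> 1 \<Longrightarrow>
           length w = num_generated Tc Ts t0 i \<Longrightarrow> f i w = last w"
    and "Copt = \<lparr>enc = f, dec = age_optimal_decoder Tc Ts t0 f\<rparr>"
  shows "valid_scheme M Tc Ts t0 U E Copt \<and>
         (\<exists>Dopt. has_average_age M Tc Ts t0 U E Copt Dopt \<and>
            (\<forall>(C :: ('a, 'a) coding_scheme) D.
               valid_scheme M Tc Ts t0 U E C \<longrightarrow> has_average_age M Tc Ts t0 U E C D \<longrightarrow>
               Dopt \<le> D))"
proof -
  interpret timing Tc Ts t0 by unfold_locales fact+
  have card: "CARD('a) \<ge> 2" using assms(1,2) by simp
  have Copt: "decoded_index Tc Ts t0 U E Copt i \<omega> = freshest G (\<lambda>j. E j \<omega>) i" for i \<omega>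
    unfolding assms(12) by (rule decoded_index_lcfs[OF card assms(11)])
  obtain Dopt where Dopt: "has_average_age M Tc Ts t0 U E Copt Dopt"
    using freshest_average_age_exists[OF assms(7,9,3,4) Copt] by blast
  have "Dopt \<le> D" if C: "valid_scheme M Tc Ts t0 U E C" and D: "has_average_age M Tc Ts t0 U E C D"
    for C :: "('a, 'a) coding_scheme" and D
  proof (rule average_age_antimono[OF assms(7) _ D Dopt])
    have "prob_space.indep_vars M (\<lambda>_. count_space UNIV) E {1..}"
      using assms(9) by (simp add: memoryless_erasures_def)
    from AE_decoded_index_le_freshest[OF assms(7) card assms(8) this assms(10) C]
    show "AE \<omega> in M. \<forall>i. decoded_index Tc Ts t0 U E C i \<omega> \<le> decoded_index Tc Ts t0 U E Copt i \<omega>"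
      unfolding Copt .
  qed
  moreover have "valid_scheme M Tc Ts t0 U E Copt"
    unfolding assms(12) by (rule valid_scheme_age_optimal)
  ultimately show ?thesis using Dopt by blast
qed

end
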